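(* Let $\varphi$ be a non-negative measurable function on $(0,1]$. Suppose $1<\vec p,\vec q<\infty$ (with $\vec p=(p_1,\dots,p_m)$, $\vec q=(q_1,\dots,q_m)$) and $\lambda>-\frac1{N_k}\sum_{i=1}^m\frac{N_{k^{(i)}}}{p_i}$. Then the weighted Hardy--Littlewood operator $\mathcal{H}_\varphi$ is bounded on $\dot B^{\vec p,\vec q,\lambda}_k(\mathbb{R}^n)$ if and only if $$\int_0^1 t^{N_k\lambda}\varphi(t)\,\mathrm{d}t<\infty.$$ Furthermore, $$\|\mathcal{H}_\varphi\|_{\dot B^{\vec p,\vec q,\lambda}_k(\mathbb{R}^n)\to\dot B^{\vec p,\vec q,\lambda}_k(\mathbb{R}^n)}=\int_0^1 t^{N_k\lambda}\varphi(t)\,\mathrm{d}t.$$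
   Context: Setting. Let $n\ge 2$, $\mathbb{R}^n=\mathbb{R}^{n_1}\times\cdots\times\mathbb{R}^{n_m}$ with $\sum_{i=1}^m n_i=n$, $n_i\ge1$. Let $k=(k_1,\dots,k_n)$ with all $k_j\ge 0$, split into blocks $k=(k^{(1)},\dots,k^{(m)})$ with $k^{(i)}=(k^{(i)}_1,\dots,k^{(i)}_{n_i})$. Put $N_{k^{(i)}}=n_i+2\sum_{v=1}^{n_i}k^{(i)}_v$ and $N_k=n+2\sum_{j=1}^n k_j=\sum_{i=1}^m N_{k^{(i)}}$. The Dunkl measure is $\mathrm{d}\mu_k(x)=\prod_{j=1}^n|x_j|^{2k_j}\,\mathrm{d}x$; write $|E|_k=\mu_k(E)$. $B(0,R)$ is the open Euclidean ball in $\mathbb{R}^n$ of center $0$ and radius $R$. On each unit sphere $\mathbb{S}^{n_i-1}\subset\mathbb{R}^{n_i}$ let $\mathrm{d}\sigma_{k^{(i)}}(\omega)=\prod_{v=1}^{n_i}|\omega_v|^{2k^{(i)}_v}\,\mathrm{d}\sigma(\omega)$, $\mathrm{d}\sigma$ the surface measure (counting measure on $\{\pm1\}$ if $n_i=1$). Vector inequalities such as $1<\vec p<\infty$ are understood componentwise. Mixed-norm radial-angular Dunkl--Lebesgue space. For $1<\vec p,\vec q<\infty$ and measurable $f:\mathbb{R}^n\to\mathbb{C}$, writing $x_i=\rho_i\omega_i\in\mathbb{R}^{n_i}$ in polar coordinates, $\|f\|_{L^{\vec p}_{\mathrm{rad},k}L^{\vec q}_{\mathrm{ang},k}(\mathbb{R}^n)}$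 is obtained by taking successively, for $i=1,2,\dots,m$ (block $1$ innermost), first the $L^{q_i}(\mathbb{S}^{n_i-1},\mathrm{d}\sigma_{k^{(i)}})$ norm in $\omega_i$ and then the $L^{p_i}((0,\infty),\rho_i^{N_{k^{(i)}}-1}\mathrm{d}\rho_i)$ norm in $\rho_i$; i.e. $$\|f\|=\Biggl(\int_0^\infty\Biggl(\int_{\mathbb{S}^{n_m-1}}\cdots\Biggl(\int_0^\infty\Biggl(\int_{\mathbb{S}^{n_1-1}}|f(\rho_1\omega_1,\dots,\rho_m\omega_m)|^{q_1}\mathrm{d}\sigma_{k^{(1)}}(\omega_1)\Biggr)^{\frac{p_1}{q_1}}\rho_1^{N_{k^{(1)}}-1}\mathrm{d}\rho_1\Biggr)^{\frac{q_2}{p_1}}\cdots\mathrm{d}\sigma_{k^{(m)}}(\omega_m)\Biggr)^{\frac{p_m}{q_m}}\rho_m^{N_{k^{(m)}}-1}\mathrm{d}\rho_m\Biggr)^{\frac1{p_m}}.$$ Mixed-norm radial-angular Dunkl $\lambda$-central Morrey space. For $\lambda\in\mathbb{R}$, $\dot B^{\vec p,\vec q,\lambda}_k(\mathbb{R}^n)$ is the set of measurable $f$ with $$\|f\|_{\dot B^{\vec p,\vec q,\lambda}_k(\mathbb{R}^n)}=\sup_{R>0}\frac{\|f\chi_{B(0,R)}\|_{L^{\vec p}_{\mathrm{rad},k}L^{\vec q}_{\mathrm{ang},k}(\mathbb{R}^n)}}{|B(0,R)|_k^{\lambda}\,\|\chi_{B(0,R)}\|_{L^{\vec p}_{\mathrm{rad},k}L^{\vec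 q}_{\mathrm{ang},k}(\mathbb{R}^n)}}<\infty.$$ Operator. $\mathcal{H}_\varphi f(x)=\int_0^1 f(tx)\varphi(t)\,\mathrm{d}t$, whenever the integral is well defined. Bounded on a space $X$ means: $\mathcal{H}_\varphi f$ is defined almost everywhere for every $f\in X$ and $\|\mathcal{H}_\varphi f\|_X\le C\|f\|_X$ with $C$ independent of $f$; $\|\mathcal{H}_\varphi\|_{X\to X}$ is the least such $C$. *)

theory Defs
  imports "HOL-Analysis.Analysis"
begin

text \<open>
  The space \<open>\<real>\<^sup>n = \<real>\<^bsup>n\<^sub>1\<^esup> \<times> \<dots> \<times> \<real>\<^bsup>n\<^sub>m\<^esup>\<close> is \<^typ>\<open>real ^ 'n\<close> together with a map \<open>b\<close> that sends each
  coordinate to the number (from \<open>1\<close> to \<open>m\<close>) of its block. So \<open>n = CARD('n)\<close>, and \<open>n\<^sub>i\<close> is the cardinality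
  of \<open>block b i\<close>. A point of \<open>\<real>\<^bsup>n\<^sub>i\<^esup>\<close> is an extensional function on \<open>block b i\<close>.
\<close>

definition block :: "('n \<Rightarrow> nat) \<Rightarrow> nat \<Rightarrow> 'n set" where
  "block b i = {j. b j = i}"

text \<open>\<open>N\<^sub>k\<close> for \<open>J = UNIV\<close>, and \<open>N\<close> of the \<open>i\<close>-th part of \<open>k\<close> for \<open>J = block b i\<close>.\<close>

definition dunkl_dim :: "('n \<Rightarrow> real) \<Rightarrow> 'n set \<Rightarrow> real" where
  "dunkl_dim k J = real (card J) + 2 * (\<Sum>j\<in>J. k j)"

text \<open>The case distinction is needed because \<open>0 powr 0 = 0\<close>, whereas here \<open>\<bar>0\<bar>\<^sup>0 = 1\<close>.\<close>

definition dunkl_weight :: "('n \<Rightarrow> real) \<Rightarrow> 'n set \<Rightarrow> ('n \<Rightarrow> real) \<Rightarrow> real" where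
  "dunkl_weight k J y = (\<Prod>j\<in>J. if k j = 0 then 1 else \<bar>y j\<bar> powr (2 * k j))"

definition dunkl_measure :: "('n::finite \<Rightarrow> real) \<Rightarrow> (real ^ 'n) measure" where
  "dunkl_measure k = density lebesgue (\<lambda>x. ennreal (dunkl_weight k UNIV (\<lambda>j. x $ j)))"

text \<open>
  Surface measure of the Euclidean unit sphere in \<open>\<real>\<^sup>J\<close>, as the cone measure:
  \<open>\<sigma>(A) = card J \<cdot> \<bar>{y. 0 < \<bar>y\<bar> \<le> 1 \<and> y / \<bar>y\<bar> \<in> A}\<bar>\<close>. If \<open>J\<close> has one element, it is the counting measure
  on \<open>{1, -1}\<close>. It lives on the whole of \<open>\<real>\<^sup>J\<close> and is concentrated on the sphere.
\<close>

definition sphere_measure :: "'n set \<Rightarrow> ('n \<Rightarrow> real) measure" where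
  "sphere_measure J =
     scale_measure (of_nat (card J))
       (distr (restrict_space (Pi\<^sub>M J (\<lambda>_. lborel)) {y. 0 < L2_set y J \<and> L2_set y J \<le> 1})
          (Pi\<^sub>M J (\<lambda>_. lborel)) (\<lambda>y. \<lambda>j\<in>J. y j / L2_set y J))"

definition dunkl_sphere_measure :: "('n \<Rightarrow> real) \<Rightarrow> 'n set \<Rightarrow> ('n \<Rightarrow> real) measure" where
  "dunkl_sphere_measure k J = density (sphere_measure J) (\<lambda>\<omega>. ennreal (dunkl_weight k J \<omega>))"

text \<open>Powers of extended non-negative reals, used for positive exponents only.\<close>

definition enn_powr :: "ennreal \<Rightarrow> real \<Rightarrow> ennreal" where
  "enn_powr u a = (if u = \<infinity> then \<infinity> else ennreal (enn2real u powr a))"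

text \<open>The point \<open>x\<close> with its coordinates in \<open>J\<close> replaced by those of \<open>\<rho>\<omega>\<close>.\<close>

definition set_block :: "'n::finite set \<Rightarrow> real ^ 'n \<Rightarrow> real \<Rightarrow> ('n \<Rightarrow> real) \<Rightarrow> real ^ 'n" where
  "set_block J x \<rho> \<omega> = (\<chi> j. if j \<in> J then \<rho> * \<omega> j else x $ j)"

text \<open>
  The radial-angular norm in the block \<open>J\<close> only; the result is still a function of the
  remaining coordinates of \<open>x\<close>, and is constant in those belonging to \<open>J\<close>.
\<close>

definition block_norm ::
  "('n::finite \<Rightarrow> real) \<Rightarrow> 'n set \<Rightarrow> real \<Rightarrow> real \<Rightarrow> (real ^ 'n \<Rightarrow> ennreal) \<Rightarrow> real ^ 'n \<Rightarrow> ennreal" where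
  "block_norm k J p q F x =
     enn_powr
       (\<integral>\<^sup>+\<rho>\<in>{0<..}.
          enn_powr (\<integral>\<^sup>+\<omega>. enn_powr (F (set_block J x \<rho> \<omega>)) q \<partial>dunkl_sphere_measure k J) (p / q)
            * ennreal (\<rho> powr (dunkl_dim k J - 1)) \<partial>lborel)
       (1 / p)"

fun iterated_norm ::
  "('n::finite \<Rightarrow> nat) \<Rightarrow> ('n \<Rightarrow> real) \<Rightarrow> (nat \<Rightarrow> real) \<Rightarrow> (nat \<Rightarrow> real) \<Rightarrow> nat
     \<Rightarrow> (real ^ 'n \<Rightarrow> ennreal) \<Rightarrow> real ^ 'n \<Rightarrow> ennreal" where
  "iterated_norm b k p q 0 F = F"
| "iterated_norm b k p q (Suc i) F =
     block_norm k (block b (Suc i)) (p (Suc i)) (q (Suc i)) (iterated_norm b k p q i F)"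

text \<open>
  After the blocks \<open>1, \<dots>, m\<close> have been integrated out (block \<open>1\<close> innermost), the result no longer
  depends on the point, so it is read off at \<open>0\<close>.
\<close>

definition mixed_norm ::
  "nat \<Rightarrow> ('n::finite \<Rightarrow> nat) \<Rightarrow> ('n \<Rightarrow> real) \<Rightarrow> (nat \<Rightarrow> real) \<Rightarrow> (nat \<Rightarrow> real)
     \<Rightarrow> (real ^ 'n \<Rightarrow> complex) \<Rightarrow> ennreal" where
  "mixed_norm m b k p q f = iterated_norm b k p q m (\<lambda>x. ennreal (cmod (f x))) 0"

text \<open>The Morrey exponent \<open>\<lambda>\<close> is called \<open>l\<close>.\<close>

definition morrey_norm ::
  "nat \<Rightarrow> ('n::finite \<Rightarrow> nat) \<Rightarrow> ('n \<Rightarrow> real) \<Rightarrow> (nat \<Rightarrow> real) \<Rightarrow> (nat \<Rightarrow> real) \<Rightarrow> real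
     \<Rightarrow> (real ^ 'n \<Rightarrow> complex) \<Rightarrow> ennreal" where
  "morrey_norm m b k p q l f =
     (SUP R\<in>{0<..}. mixed_norm m b k p q (\<lambda>x. f x * indicator (ball 0 R) x)
        / (ennreal (measure (dunkl_measure k) (ball 0 R) powr l)
             * mixed_norm m b k p q (indicator (ball 0 R))))"

definition morrey_space ::
  "nat \<Rightarrow> ('n::finite \<Rightarrow> nat) \<Rightarrow> ('n \<Rightarrow> real) \<Rightarrow> (nat \<Rightarrow> real) \<Rightarrow> (nat \<Rightarrow> real) \<Rightarrow> real
     \<Rightarrow> (real ^ 'n \<Rightarrow> complex) set" where
  "morrey_space m b k p q l =
     {f. f \<in> borel_measurable lebesgue \<and> morrey_norm m b k p q l f < \<infinity>}"

definition hardy_defined_at ::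
  "(real \<Rightarrow> real) \<Rightarrow> (real ^ 'n::finite \<Rightarrow> complex) \<Rightarrow> real ^ 'n \<Rightarrow> bool" where
  "hardy_defined_at \<phi> f x \<longleftrightarrow>
     set_integrable lebesgue {0<..1} (\<lambda>t. f (t *\<^sub>R x) * complex_of_real (\<phi> t))"

definition hardy ::
  "(real \<Rightarrow> real) \<Rightarrow> (real ^ 'n::finite \<Rightarrow> complex) \<Rightarrow> real ^ 'n \<Rightarrow> complex" where
  "hardy \<phi> f x = (LINT t:{0<..1}|lebesgue. f (t *\<^sub>R x) * complex_of_real (\<phi> t))"

definition hardy_bounds ::
  "nat \<Rightarrow> ('n::finite \<Rightarrow> nat) \<Rightarrow> ('n \<Rightarrow> real) \<Rightarrow> (nat \<Rightarrow> real) \<Rightarrow> (nat \<Rightarrow> real) \<Rightarrow> real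
     \<Rightarrow> (real \<Rightarrow> real) \<Rightarrow> real set" where
  "hardy_bounds m b k p q l \<phi> =
     {C. 0 \<le> C \<and>
        (\<forall>f\<in>morrey_space m b k p q l.
           (AE x in lebesgue. hardy_defined_at \<phi> f x) \<and>
           hardy \<phi> f \<in> morrey_space m b k p q l \<and>
           morrey_norm m b k p q l (hardy \<phi> f) \<le> ennreal C * morrey_norm m b k p q l f)}"

definition hardy_bounded ::
  "nat \<Rightarrow> ('n::finite \<Rightarrow> nat) \<Rightarrow> ('n \<Rightarrow> real) \<Rightarrow> (nat \<Rightarrow> real) \<Rightarrow> (nat \<Rightarrow> real) \<Rightarrow> real
     \<Rightarrow> (real \<Rightarrow> real) \<Rightarrow> bool" where
  "hardy_bounded m b k p q l \<phi> \<longleftrightarrow> (\<exists>C. C \<in> hardy_bounds m b k p q l \<phi>)"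

text \<open>The operator norm; it is \<open>\<infinity>\<close>, the infimum of the empty set, for an unbounded operator.\<close>

definition hardy_opnorm ::
  "nat \<Rightarrow> ('n::finite \<Rightarrow> nat) \<Rightarrow> ('n \<Rightarrow> real) \<Rightarrow> (nat \<Rightarrow> real) \<Rightarrow> (nat \<Rightarrow> real) \<Rightarrow> real
     \<Rightarrow> (real \<Rightarrow> real) \<Rightarrow> ennreal" where
  "hardy_opnorm m b k p q l \<phi> = (INF C\<in>hardy_bounds m b k p q l \<phi>. ennreal C)"

end

theory Submission
  imports Defs
begin

text \<open>
  Under the dilation \<open>x \<mapsto> t x\<close> the mixed norm scales like a power of \<open>t\<close>, and the Morrey norm is
  normalised so that \<open>\<parallel>f(t \<cdot>)\<parallel> \<le> t\<^bsup>N\<lambda>\<^esup> \<parallel>f\<parallel>\<close>; so Minkowski's integral inequality, applied to the successive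
  norms, bounds the operator by \<open>\<integral> t\<^bsup>N\<lambda>\<^esup> \<phi>(t) dt\<close>. The function \<open>\<bar>x\<bar>\<^bsup>N\<lambda>\<^esup>\<close> is an eigenfunction with this
  eigenvalue, and it belongs to the space because of the lower bound on \<open>\<lambda>\<close>. Changing a function on a
  null set does not affect its mixed norm, which allows one to pass from Lebesgue to Borel measurable
  functions; this is Fubini's theorem together with polar coordinates in each block, both of which are
  needed for null sets only.
\<close>

section \<open>Minkowski's integral inequality\<close>

text \<open>Sections of a Lebesgue measurable \<open>f\<close> along spheres, radii and rays need
  not be measurable, so neither Tonelli nor Minkowski applies to \<open>f\<close> itself. Both
  \<open>f\<close> and \<open>\<phi>\<close> are exchanged for Borel versions \<open>g\<close> and
  \<open>\<psi>\<close>, and the exchange has to be justified for iterated norms of functions that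
  may fail to be measurable. It rests on one fact about measurable functions: the iterated norm of a
  Borel function is zero exactly when the function vanishes almost everywhere. A Euclidean ball is
  not a product over the blocks, so the norm of a ball is never computed. Only its homogeneity in
  the radius is used, and that it is positive and finite for the unit ball; all such constants
  cancel in the end. The condition on \<lambda> says that the exponent of \<open>R\<close> in the
  Morrey denominator is positive, and the same positivity makes the extremal power have finite norm
  on the unit ball. Minkowski's inequality is derived from Young's inequality with a well chosen
  weight instead of duality, so that everything takes place among extended non-negative numbers
  without prior finiteness.\<close>

lemma enn_powr_eq_0_iff [simp]: "enn_powr u a = 0 \<longleftrightarrow> u = 0"
  by (cases u) (auto simp: enn_powr_def)

lemma enn_powr_eq_top_iff [simp]: "enn_powr u a = top \<longleftrightarrow> u = top"
  by (auto simp: enn_powr_def)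

lemma enn_powr_0 [simp]: "enn_powr 0 a = 0"
  by simp

lemma enn_powr_top [simp]: "enn_powr top a = top"
  by simp

lemma enn_powr_ennreal [simp]: "0 \<le> x \<Longrightarrow> enn_powr (ennreal x) a = ennreal (x powr a)"
  by (simp add: enn_powr_def)

lemma enn_powr_1 [simp]: "enn_powr u 1 = u"
  by (cases u) auto

lemma enn_powr_one [simp]: "enn_powr 1 a = 1"
  using enn_powr_ennreal[of 1 a] by simp

lemma enn_powr_mono: "u \<le> v \<Longrightarrow> 0 \<le> a \<Longrightarrow> enn_powr u a \<le> enn_powr v a"
  by (cases u; cases v) (auto simp: powr_mono2 top_unique)

text \<open>Multiplicative for every exponent: \<open>0\<close> is sent to \<open>0\<close> and
  \<open>top\<close> to \<open>top\<close> whatever \<open>a\<close> is, which agrees with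
  \<open>0 * top = 0\<close>.\<close>

lemma enn_powr_mult: "enn_powr (u * v) a = enn_powr u a * enn_powr v a"
proof (cases "u = top \<or> v = top")
  case True
  then show ?thesis by (auto simp: ennreal_mult_top ennreal_top_mult ennreal_mult_eq_top_iff)
next
  case False
  then show ?thesis
    by (cases u; cases v) (auto simp: powr_mult simp flip: ennreal_mult)
qed

lemma enn_powr_powr: "enn_powr (enn_powr u a) c = enn_powr u (a * c)"
  by (cases u) (auto simp: powr_powr)

lemma measurable_enn_powr [measurable (raw)]:
  assumes [measurable]: "f \<in> borel_measurable M"
  shows "(\<lambda>x. enn_powr (f x) a) \<in> borel_measurable M"
  unfolding enn_powr_def by measurable

section \<open>Norms of functions with values in the extended non-negative reals\<close>

definition Lp_norm :: "'a measure \<Rightarrow> real \<Rightarrow> ('a \<Rightarrow> ennreal) \<Rightarrow> ennreal" where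
  "Lp_norm M p f = enn_powr (\<integral>\<^sup>+x. enn_powr (f x) p \<partial>M) (1 / p)"

lemma Lp_norm_mono_AE:
  assumes "AE x in M. f x \<le> g x" "0 < p"
  shows "Lp_norm M p f \<le> Lp_norm M p g"
  unfolding Lp_norm_def
  by (intro enn_powr_mono nn_integral_mono_AE) (use assms in \<open>auto elim!: eventually_mono intro: enn_powr_mono\<close>)

lemma Lp_norm_cong_AE:
  assumes "AE x in M. f x = g x"
  shows "Lp_norm M p f = Lp_norm M p g"
  unfolding Lp_norm_def
  by (intro arg_cong2[where f = enn_powr] nn_integral_cong_AE refl)
     (use assms in \<open>auto elim!: eventually_mono\<close>)

lemma Lp_norm_eq_0_iff:
  assumes "f \<in> borel_measurable M"
  shows "Lp_norm M p f = 0 \<longleftrightarrow> (AE x in M. f x = 0)"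
  using assms by (simp add: Lp_norm_def nn_integral_0_iff_AE)

lemma Lp_norm_cmult:
  assumes "f \<in> borel_measurable M" "p > 0"
  shows "Lp_norm M p (\<lambda>x. c * f x) = c * Lp_norm M p f"
  using assms by (simp add: Lp_norm_def enn_powr_mult nn_integral_cmult enn_powr_powr)

lemma Lp_norm_const:
  assumes "p > 0"
  shows "Lp_norm M p (\<lambda>x. c) = c * enn_powr (emeasure M (space M)) (1 / p)"
  using assms by (simp add: Lp_norm_def enn_powr_mult enn_powr_powr)

lemma measurable_Lp_norm [measurable (raw)]:
  assumes "sigma_finite_measure M" "case_prod f \<in> borel_measurable (N \<Otimes>\<^sub>M M)"
  shows "(\<lambda>x. Lp_norm M p (f x)) \<in> borel_measurable N"
proof -
  interpret sigma_finite_measure M by fact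
  note assms(2)[measurable]
  have "(\<lambda>(x, y). enn_powr (f x y) p) \<in> borel_measurable (N \<Otimes>\<^sub>M M)"
    by measurable
  then have [measurable]: "(\<lambda>x. \<integral>\<^sup>+y. enn_powr (f x y) p \<partial>M) \<in> borel_measurable N"
    by (rule borel_measurable_nn_integral)
  show ?thesis
    unfolding Lp_norm_def by measurable
qed

text \<open>Weighted arithmetic-geometric mean of \<open>a\<close> and
  \<open>a powr (1 - p) * x powr p\<close>: this is the tangent to the \<open>p\<close>-th power at
  \<open>a\<close>, solved for \<open>x\<close>, with equality at \<open>x = a\<close>. It bounds
  \<open>x\<close> linearly by its \<open>p\<close>-th power, with \<open>a\<close> still
  free.\<close>

lemma Young_scaled:
  fixes x :: ennreal and a p :: real
  assumes "a > 0" "p \<ge> 1"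
  shows "x \<le> ennreal ((1 - 1 / p) * a) + ennreal (a powr (1 - p) / p) * enn_powr x p"
proof (cases x)
  case (real r)
  have "r \<le> (1 - 1 / p) * a + (a powr (1 - p) / p) * r powr p"
  proof (cases "r = 0")
    case True
    then show ?thesis using assms by simp
  next
    case False
    with real have r: "r > 0" by simp
    have "a powr (1 - 1 / p) * (a powr (1 - p) * r powr p) powr (1 / p)
        \<le> (1 - 1 / p) * a + (1 / p) * (a powr (1 - p) * r powr p)"
      using assms r by (intro Youngs_inequality_0) auto
    moreover have "a powr (1 - 1 / p) * (a powr (1 - p) * r powr p) powr (1 / p) = r"
    proof -
      have "(1 - p) * (1 / p) = - (1 - 1 / p)" "p * (1 / p) = 1"
        using assms by (simp_all add: field_simps)
      then have "(a powr (1 - p) * r powr p) powr (1 / p) = a powr (- (1 - 1 / p)) * r"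
        using assms r by (simp only: powr_mult powr_powr) simp
      then show ?thesis
        using assms by (simp add: powr_add[symmetric] mult.assoc[symmetric])
    qed
    ultimately show ?thesis by simp
  qed
  with real assms show ?thesis
    by (simp add: ennreal_mult[symmetric] ennreal_plus[symmetric] ennreal_leI del: ennreal_plus)
next
  case top
  with assms show ?thesis by (simp add: ennreal_mult_top)
qed

text \<open>The choice \<open>c = (X / W) powr (1 / p)\<close> is optimal.\<close>

lemma Young_optimal:
  fixes g X :: ennreal and W p :: real
  assumes W: "W > 0" and p: "p \<ge> 1"
    and le: "\<And>c. c > 0 \<Longrightarrow> g \<le> ennreal ((1 - 1 / p) * c * W) + ennreal (c powr (1 - p) / p) * X"
  shows "enn_powr g p \<le> ennreal (W powr (p - 1)) * X"
proof (cases X)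
  case top
  with W show ?thesis by (simp add: ennreal_mult_top)
next
  case (real x)
  have le': "g \<le> ennreal ((1 - 1 / p) * c * W + c powr (1 - p) / p * x)" if "c > 0" for c
  proof -
    have "ennreal (c powr (1 - p) / p) * X = ennreal (c powr (1 - p) / p * x)"
      using real p by (subst ennreal_mult) auto
    moreover have "0 \<le> (1 - 1 / p) * c * W" "0 \<le> c powr (1 - p) / p * x"
      using that real p W by auto
    ultimately show ?thesis
      using le[OF that] by (simp only: ennreal_plus)
  qed
  obtain r where r: "g = ennreal r" "r \<ge> 0"
    using le'[of 1] by (cases g) (auto simp: top_unique)
  have ler: "r \<le> (1 - 1 / p) * c * W + c powr (1 - p) / p * x" if "c > 0" for c
  proof -
    have "0 \<le> (1 - 1 / p) * c * W + c powr (1 - p) / p * x"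
      using that real p W by auto
    then show ?thesis
      using le'[OF that] r by (simp only: ennreal_le_iff)
  qed
  have "r powr p \<le> W powr (p - 1) * x"
  proof (cases "x = 0")
    case True
    \<comment> \<open>Here the optimal \<open>c\<close> would degenerate to \<open>0\<close>, so
      arbitrarily small values are used, divided by \<open>W\<close> to make the bound at most
      \<open>c\<close>.\<close>
    have "r \<le> c" if "c > 0" for c
    proof -
      have "r \<le> (1 - 1 / p) * c"
        using ler[of "c / W"] that W True by simp
      also have "\<dots> \<le> 1 * c"
        using that p by (intro mult_right_mono) auto
      finally show ?thesis by simp
    qed
    then have "r \<le> 0" by (rule field_le_epsilon) simp
    with r True show ?thesis by simp
  next
    case False
    with real have x: "x > 0" by simp
    define c where "c = (x / W) powr (1 / p)"
    have c: "c > 0" using x W by (simp add: c_def)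
    \<comment> \<open>For this \<open>c\<close> the two summands are multiples of one and the same
      number, with weights \<open>1 - 1 / p\<close> and \<open>1 / p\<close> of sum
      \<open>1\<close>.\<close>
    have "c * W = x powr (1 / p) * W powr (1 - 1 / p)"
      using x W by (simp add: c_def powr_divide powr_diff)
    moreover have "c powr (1 - p) * x = x powr (1 / p) * W powr (1 - 1 / p)"
    proof -
      have "c powr (1 - p) = (x / W) powr (1 / p - 1)"
      proof -
        have "1 / p * (1 - p) = 1 / p - 1"
          using p by (simp add: field_simps)
        then show ?thesis by (simp only: c_def powr_powr)
      qed
      also have "\<dots> = x powr (1 / p - 1) * W powr (1 - 1 / p)"
        using x W by (simp add: powr_divide powr_diff)
      finally show ?thesis
        using x by (simp add: powr_diff)
    qed
    moreover have "r \<le> (1 - 1 / p) * (c * W) + (1 / p) * (c powr (1 - p) * x)"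
      using ler[OF c] by (simp add: mult.assoc)
    ultimately have "r \<le> (1 - 1 / p) * (x powr (1 / p) * W powr (1 - 1 / p)) + (1 / p) * (x powr (1 / p) * W powr (1 - 1 / p))"
      by (simp only:)
    then have "r \<le> x powr (1 / p) * W powr (1 - 1 / p)"
      by (simp only: distrib_right[symmetric]) simp
    then have "r powr p \<le> (x powr (1 / p) * W powr (1 - 1 / p)) powr p"
      using r p by (intro powr_mono2) auto
    also have "\<dots> = W powr (p - 1) * x"
    proof -
      have "1 / p * p = 1" "(1 - 1 / p) * p = p - 1"
        using p by (simp_all add: field_simps)
      then show ?thesis
        using x by (simp add: powr_mult powr_powr)
    qed
    finally show ?thesis .
  qed
  with r real show ?thesis
    by (simp add: ennreal_mult[symmetric] ennreal_leI)
qed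

text \<open>With \<open>w s\<close> the norm of \<open>F s\<close> and \<open>W\<close> its
  integral, weighting by \<open>w\<close> bounds the \<open>p\<close>-th power of the integral of
  \<open>F s y\<close> by \<open>W powr (p - 1)\<close> times the integral of
  \<open>w s powr (1 - p) * F s y powr p\<close>. Integrating over \<open>y\<close> and exchanging
  the integrals turns the last factor into the integral of \<open>w\<close>, that is
  \<open>W\<close>, and the total is \<open>W powr p\<close>.\<close>

theorem Minkowski_integral_inequality:
  assumes "sigma_finite_measure M" "sigma_finite_measure N" "p \<ge> 1"
    and F: "case_prod F \<in> borel_measurable (M \<Otimes>\<^sub>M N)"
  shows "Lp_norm N p (\<lambda>y. \<integral>\<^sup>+s. F s y \<partial>M) \<le> (\<integral>\<^sup>+s. Lp_norm N p (F s) \<partial>M)"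
proof -
  interpret M: sigma_finite_measure M by fact
  interpret N: sigma_finite_measure N by fact
  interpret pair_sigma_finite M N ..
  interpret Q: pair_sigma_finite N M ..
  note F[measurable]
  have F'[measurable]: "(\<lambda>(y, s). F s y) \<in> borel_measurable (N \<Otimes>\<^sub>M M)"
    by measurable
  have p: "p > 0" using assms by simp
  define w where "w s = Lp_norm N p (F s)" for s
  have w[measurable]: "w \<in> borel_measurable M"
    unfolding w_def by (rule measurable_Lp_norm) (use N.sigma_finite_measure_axioms F in auto)
  define W where "W = (\<integral>\<^sup>+s. w s \<partial>M)"
  \<comment> \<open>Where \<open>w s = 0\<close> the weight is lost, since
    \<open>0 powr a = 0\<close>. These \<open>s\<close> are harmless because \<open>F s\<close>
    vanishes almost everywhere; Fubini for null sets moves the exceptional set from each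
    \<open>s\<close> to almost every \<open>y\<close>.\<close>
  have zero: "AE y in N. AE s in M. w s = 0 \<longrightarrow> F s y = 0"
  proof -
    have "AE s in M. AE y in N. w s = 0 \<longrightarrow> F s y = 0"
    proof (rule AE_I2)
      fix s assume s: "s \<in> space M"
      then have [measurable]: "F s \<in> borel_measurable N" by measurable
      show "AE y in N. w s = 0 \<longrightarrow> F s y = 0"
        by (cases "w s = 0") (auto simp: w_def Lp_norm_eq_0_iff)
    qed
    then show ?thesis
      by (subst (asm) AE_commute) simp
  qed
  consider "W = top" | "W = 0" | r where "W = ennreal r" "r > 0"
    by (cases W) (auto simp: less_le)
  then show ?thesis
  proof cases
    case 1
    then show ?thesis by (simp add: W_def w_def)
  next
    case 2
    then have w0: "AE s in M. w s = 0" by (simp add: W_def nn_integral_0_iff_AE)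
    have "AE y in N. (\<integral>\<^sup>+s. F s y \<partial>M) = 0"
      using zero
    proof eventually_elim
      case (elim y)
      with w0 have "AE s in M. F s y = 0" by eventually_elim simp
      then have "(\<integral>\<^sup>+s. F s y \<partial>M) = (\<integral>\<^sup>+s. 0 \<partial>M)" by (intro nn_integral_cong_AE)
      then show ?case by simp
    qed
    then have "Lp_norm N p (\<lambda>y. \<integral>\<^sup>+s. F s y \<partial>M) = Lp_norm N p (\<lambda>y. 0)"
      by (rule Lp_norm_cong_AE)
    then show ?thesis using p by (simp add: Lp_norm_const)
  next
    case (3 r)
    \<comment> \<open>The power of \<open>w s\<close> is chosen so that \<open>K s\<close> has
      integral \<open>w s\<close> over \<open>y\<close>.\<close>
    define K where "K s y = ennreal (enn2real (w s) powr (1 - p)) * enn_powr (F s y) p" for s y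
    have K[measurable]: "case_prod K \<in> borel_measurable (M \<Otimes>\<^sub>M N)"
      unfolding K_def by measurable
    have fin: "AE s in M. w s \<noteq> top"
      using 3 nn_integral_PInf_AE[of w M] by (simp add: W_def)
    \<comment> \<open>Young's inequality at the point \<open>c * w s\<close>, integrated over
      \<open>s\<close>, gives a bound for every \<open>c\<close>; the optimal \<open>c\<close> then
      depends on \<open>y\<close>.\<close>
    have "AE y in N. enn_powr (\<integral>\<^sup>+s. F s y \<partial>M) p \<le> ennreal (r powr (p - 1)) * (\<integral>\<^sup>+s. K s y \<partial>M)"
      using zero AE_space
    proof eventually_elim
      case (elim y)
      then have y[measurable]: "y \<in> space N" by simp
      have [measurable]: "(\<lambda>s. F s y) \<in> borel_measurable M" "(\<lambda>s. K s y) \<in> borel_measurable M"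
        by measurable
      show ?case
      proof (rule Young_optimal)
        fix c :: real assume c: "c > 0"
        have "(\<integral>\<^sup>+s. F s y \<partial>M) \<le>
          (\<integral>\<^sup>+s. ennreal ((1 - 1 / p) * c) * w s + ennreal (c powr (1 - p) / p) * K s y \<partial>M)"
        proof (rule nn_integral_mono_AE)
          show "AE s in M. F s y \<le> ennreal ((1 - 1 / p) * c) * w s + ennreal (c powr (1 - p) / p) * K s y"
            using elim(1) fin
          proof eventually_elim
            case (elim s)
            show ?case
            proof (cases "w s = 0")
              case True
              then show ?thesis using elim by simp
            next
              case False
              then obtain v where v: "w s = ennreal v" "v > 0"
                using elim by (cases "w s") (auto simp: less_le)
              show ?thesis
              proof -
                have "ennreal ((1 - 1 / p) * (c * v)) = ennreal ((1 - 1 / p) * c) * w s"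
                  using v c assms(3) by (simp add: mult.assoc flip: ennreal_mult)
                moreover have "(c * v) powr (1 - p) / p = c powr (1 - p) / p * v powr (1 - p)"
                  using v c by (simp add: powr_mult)
                then have "ennreal ((c * v) powr (1 - p) / p) * enn_powr (F s y) p
                    = ennreal (c powr (1 - p) / p) * K s y"
                  using v c p by (simp add: K_def ennreal_mult[symmetric] mult.assoc[symmetric] del: times_divide_eq_left)
                ultimately show ?thesis
                  using Young_scaled[of "c * v" p "F s y"] v c assms(3) by simp
              qed
            qed
          qed
        qed
        also have "\<dots> = ennreal ((1 - 1 / p) * c) * W + ennreal (c powr (1 - p) / p) * (\<integral>\<^sup>+s. K s y \<partial>M)"
          by (simp add: nn_integral_add nn_integral_cmult W_def)
        also have "ennreal ((1 - 1 / p) * c) * W = ennreal ((1 - 1 / p) * c * r)"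
          using c 3 assms(3) by (simp add: ennreal_mult)
        finally show "(\<integral>\<^sup>+s. F s y \<partial>M) \<le>
          ennreal ((1 - 1 / p) * c * r) + ennreal (c powr (1 - p) / p) * (\<integral>\<^sup>+s. K s y \<partial>M)" .
      qed (use 3 assms in auto)
    qed
    then have "(\<integral>\<^sup>+y. enn_powr (\<integral>\<^sup>+s. F s y \<partial>M) p \<partial>N) \<le>
        (\<integral>\<^sup>+y. ennreal (r powr (p - 1)) * (\<integral>\<^sup>+s. K s y \<partial>M) \<partial>N)"
      by (rule nn_integral_mono_AE)
    also have "\<dots> = ennreal (r powr (p - 1)) * (\<integral>\<^sup>+y. \<integral>\<^sup>+s. K s y \<partial>M \<partial>N)"
      by (rule nn_integral_cmult) measurable
    also have "(\<integral>\<^sup>+y. \<integral>\<^sup>+s. K s y \<partial>M \<partial>N) = (\<integral>\<^sup>+s. \<integral>\<^sup>+y. K s y \<partial>N \<partial>M)"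
      by (rule Fubini') measurable
    also have "\<dots> = (\<integral>\<^sup>+s. w s \<partial>M)"
    proof (rule nn_integral_cong_AE)
      show "AE s in M. (\<integral>\<^sup>+y. K s y \<partial>N) = w s"
        using fin AE_space
      proof eventually_elim
        case (elim s)
        then have [measurable]: "F s \<in> borel_measurable N" by measurable
        have "(\<integral>\<^sup>+y. K s y \<partial>N) = ennreal (enn2real (w s) powr (1 - p)) * (\<integral>\<^sup>+y. enn_powr (F s y) p \<partial>N)"
          unfolding K_def by (rule nn_integral_cmult) measurable
        also have "(\<integral>\<^sup>+y. enn_powr (F s y) p \<partial>N) = enn_powr (w s) p"
          using p by (simp add: w_def Lp_norm_def enn_powr_powr)
        also have "ennreal (enn2real (w s) powr (1 - p)) * enn_powr (w s) p = w s"
          using elim by (cases "w s") (auto simp: powr_add[symmetric] simp flip: ennreal_mult)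
        finally show ?case .
      qed
    qed
    also have "\<dots> = ennreal r"
      using 3 by (simp add: W_def)
    also have "ennreal (r powr (p - 1)) * ennreal r = ennreal (r powr p)"
      using 3 by (simp add: ennreal_mult[symmetric] powr_diff)
    finally have "Lp_norm N p (\<lambda>y. \<integral>\<^sup>+s. F s y \<partial>M) \<le> enn_powr (ennreal (r powr p)) (1 / p)"
      unfolding Lp_norm_def using p by (intro enn_powr_mono) auto
    also have "\<dots> = ennreal r"
      using 3 p by (simp add: powr_powr)
    also have "\<dots> = (\<integral>\<^sup>+s. Lp_norm N p (F s) \<partial>M)"
      using 3 by (simp add: W_def w_def)
    finally show ?thesis .
  qed
qed

section \<open>Sphere and radial measures\<close>

lemma measurable_vec_nth [measurable]: "(\<lambda>x::real ^ 'n::finite. x $ j) \<in> borel_measurable borel"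
  by (intro borel_measurable_continuous_onI continuous_intros)

lemma measurable_PiM_lborel_component:
  "j \<in> I \<Longrightarrow> (\<lambda>y. y j) \<in> borel_measurable (Pi\<^sub>M I (\<lambda>_. lborel :: real measure))"
  using measurable_component_singleton[of j I "\<lambda>_. lborel :: real measure"] by simp

lemma measurable_L2_set [measurable]:
  "(\<lambda>y. L2_set y J) \<in> borel_measurable (Pi\<^sub>M J (\<lambda>_. lborel :: real measure))"
  unfolding L2_set_def
  by (intro measurable_compose[OF _ borel_measurable_sqrt] borel_measurable_sum borel_measurable_power
      measurable_PiM_lborel_component)

lemma measurable_dunkl_weight [measurable]:
  "dunkl_weight k J \<in> borel_measurable (Pi\<^sub>M J (\<lambda>_. lborel))"
proof -
  have "(\<lambda>y. if k j = 0 then 1 else \<bar>y j\<bar> powr (2 * k j)) \<in> borel_measurable (Pi\<^sub>M J (\<lambda>_. lborel))"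
    if "j \<in> J" for j
  proof -
    note measurable_PiM_lborel_component[OF that, measurable]
    show ?thesis by measurable
  qed
  then show ?thesis
    unfolding dunkl_weight_def[abs_def] by (intro borel_measurable_prod)
qed

lemma measurable_vec_dunkl_weight [measurable]:
  "(\<lambda>x::real ^ 'n::finite. dunkl_weight k J (\<lambda>j. x $ j)) \<in> borel_measurable borel"
  unfolding dunkl_weight_def by measurable

lemma measurable_set_block [measurable (raw)]:
  fixes X :: "'a \<Rightarrow> real ^ 'n::finite"
  assumes [measurable]: "X \<in> borel_measurable M" "r \<in> borel_measurable M"
    and w: "w \<in> M \<rightarrow>\<^sub>M Pi\<^sub>M J (\<lambda>_. lborel)"
  shows "(\<lambda>z. set_block J (X z) (r z) (w z)) \<in> borel_measurable M"
proof (subst borel_measurable_euclidean_space, intro ballI)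
  fix e :: "real ^ 'n" assume "e \<in> Basis"
  then obtain j where e: "e = axis j 1"
    by (auto simp: Basis_vec_def)
  show "(\<lambda>z. set_block J (X z) (r z) (w z) \<bullet> e) \<in> borel_measurable M"
  proof (cases "j \<in> J")
    case True
    have "(\<lambda>z. w z j) \<in> M \<rightarrow>\<^sub>M lborel"
      by (rule measurable_compose[OF w]) (rule measurable_component_singleton[OF True])
    then have [measurable]: "(\<lambda>z. w z j) \<in> borel_measurable M" by simp
    show ?thesis
      using True by (simp add: e set_block_def inner_axis)
  next
    case False
    then show ?thesis
      by (simp add: e set_block_def inner_axis)
  qed
qed

lemma space_sphere_measure [simp]: "space (sphere_measure J) = space (Pi\<^sub>M J (\<lambda>_. lborel))"
  by (simp add: sphere_measure_def space_scale_measure)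

lemma sets_sphere_measure [measurable_cong, simp]:
  "sets (sphere_measure J) = sets (Pi\<^sub>M J (\<lambda>_. lborel))"
  by (simp add: sphere_measure_def)

lemma space_dunkl_sphere_measure [simp]:
  "space (dunkl_sphere_measure k J) = space (Pi\<^sub>M J (\<lambda>_. lborel))"
  by (simp add: dunkl_sphere_measure_def)

lemma sets_dunkl_sphere_measure [measurable_cong, simp]:
  "sets (dunkl_sphere_measure k J) = sets (Pi\<^sub>M J (\<lambda>_. lborel))"
  by (simp add: dunkl_sphere_measure_def)

lemma measurable_normalize:
  "(\<lambda>y. \<lambda>j\<in>J. y j / L2_set y J) \<in> Pi\<^sub>M J (\<lambda>_. lborel) \<rightarrow>\<^sub>M Pi\<^sub>M J (\<lambda>_. lborel :: real measure)"
proof (rule measurable_restrict)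
  fix j assume "j \<in> J"
  note measurable_PiM_lborel_component[OF this, measurable]
  have "(\<lambda>y. y j / L2_set y J) \<in> borel_measurable (Pi\<^sub>M J (\<lambda>_. lborel :: real measure))"
    by measurable
  then show "(\<lambda>y. y j / L2_set y J) \<in> Pi\<^sub>M J (\<lambda>_. lborel :: real measure) \<rightarrow>\<^sub>M lborel"
    by simp
qed

lemma sets_punctured_ball:
  "{y. 0 < L2_set y J \<and> L2_set y J \<le> 1} \<inter> space (Pi\<^sub>M J (\<lambda>_. lborel))
     \<in> sets (Pi\<^sub>M J (\<lambda>_. lborel :: real measure))"
proof -
  have "{y \<in> space (Pi\<^sub>M J (\<lambda>_. lborel :: real measure)). 0 < L2_set y J \<and> L2_set y J \<le> 1}
     \<in> sets (Pi\<^sub>M J (\<lambda>_. lborel :: real measure))"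
    by measurable
  then show ?thesis by (simp add: Int_def conj_commute)
qed

lemma AE_scale_measure_iff:
  assumes "r \<noteq> 0"
  shows "(AE x in scale_measure r M. P x) \<longleftrightarrow> (AE x in M. P x)"
proof -
  have "null_sets (scale_measure r M) = null_sets M"
    using assms by (auto simp: null_sets_def)
  then show ?thesis
    by (simp add: eventually_ae_filter space_scale_measure)
qed

text \<open>Unfolds the cone measure, so that null sets of the sphere become null sets of the
  punctured ball. The set \<open>J\<close> has to be nonempty because otherwise the factor
  \<open>card J\<close> makes the measure zero.\<close>

lemma AE_sphere_measure_iff:
  assumes J: "finite J" "J \<noteq> {}"
    and P: "{\<omega> \<in> space (Pi\<^sub>M J (\<lambda>_. lborel)). P \<omega>} \<in> sets (Pi\<^sub>M J (\<lambda>_. lborel))"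
  shows "(AE \<omega> in sphere_measure J. P \<omega>) \<longleftrightarrow>
    (AE y in Pi\<^sub>M J (\<lambda>_. lborel). 0 < L2_set y J \<and> L2_set y J \<le> 1 \<longrightarrow> P (\<lambda>j\<in>J. y j / L2_set y J))"
proof -
  have "of_nat (card J) \<noteq> (0::ennreal)"
    using J by simp
  then show ?thesis
    unfolding sphere_measure_def
    by (subst AE_scale_measure_iff, simp, subst AE_distr_iff)
       (use P in \<open>auto simp: AE_restrict_space_iff[OF sets_punctured_ball]
          intro!: measurable_restrict_space1 measurable_normalize\<close>)
qed

interpretation PiL: product_sigma_finite "\<lambda>_. lborel :: real measure"
  by (rule product_sigma_finite.intro) (rule sigma_finite_lborel)

text \<open>The punctured unit ball lies in the cube with sides \<open>{-1..1}\<close>.\<close>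

lemma emeasure_sphere_measure_finite:
  assumes "finite J"
  shows "emeasure (sphere_measure J) (space (sphere_measure J)) < \<infinity>"
proof -
  let ?L = "Pi\<^sub>M J (\<lambda>_. lborel :: real measure)"
  let ?B = "{y. 0 < L2_set y J \<and> L2_set y J \<le> 1}"
  have "emeasure ?L (?B \<inter> space ?L) \<le> emeasure ?L (Pi\<^sub>E J (\<lambda>_. {-1..1}))"
  proof (rule emeasure_mono)
    show "?B \<inter> space ?L \<subseteq> Pi\<^sub>E J (\<lambda>_. {-1..1})"
    proof
      fix y assume y: "y \<in> ?B \<inter> space ?L"
      have "\<bar>y j\<bar> \<le> 1" if "j \<in> J" for j
      proof -
        have "L2_set y J = L2_set (\<lambda>j. \<bar>y j\<bar>) J"
          by (simp add: L2_set_def)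
        then show ?thesis
          using member_le_L2_set[OF assms that, of "\<lambda>j. \<bar>y j\<bar>"] y by auto
      qed
      with y show "y \<in> Pi\<^sub>E J (\<lambda>_. {-1..1})"
        by (force simp: space_PiM PiE_def abs_le_iff)
    qed
    show "Pi\<^sub>E J (\<lambda>_. {-1..1}) \<in> sets ?L"
      using assms by (intro sets_PiM_I_finite) auto
  qed
  also have "\<dots> = (\<Prod>j\<in>J. emeasure lborel {-1..1::real})"
    using assms by (intro PiL.emeasure_PiM) auto
  also have "\<dots> < \<infinity>"
    by (simp add: power_less_top_ennreal)
  finally have "emeasure ?L (?B \<inter> space ?L) < \<infinity>" .
  moreover have "emeasure (sphere_measure J) (space (sphere_measure J))
      = of_nat (card J) * emeasure ?L (?B \<inter> space ?L)"
  proof -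
    let ?R = "restrict_space ?L ?B"
    let ?f = "\<lambda>y. \<lambda>j\<in>J. y j / L2_set y J"
    have f: "?f \<in> ?R \<rightarrow>\<^sub>M ?L"
      by (intro measurable_restrict_space1 measurable_normalize)
    have "emeasure (distr ?R ?L ?f) (space ?L) = emeasure ?R (?f -` space ?L \<inter> space ?R)"
      using f by (rule emeasure_distr) simp
    also have "?f -` space ?L \<inter> space ?R = ?B \<inter> space ?L"
      using measurable_space[OF f] by (auto simp: space_restrict_space)
    also have "emeasure ?R (?B \<inter> space ?L) = emeasure ?L (?B \<inter> space ?L)"
      by (rule emeasure_restrict_space[OF sets_punctured_ball]) auto
    finally show ?thesis
      by (simp only: sphere_measure_def space_scale_measure emeasure_scale_measure space_distr)
  qed
  ultimately show ?thesis
    by (simp add: ennreal_mult_less_top of_nat_less_top)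
qed

lemma AE_sphere_measure_L2_set:
  assumes "finite J" "J \<noteq> {}"
  shows "AE \<omega> in sphere_measure J. L2_set \<omega> J = 1"
proof (subst AE_sphere_measure_iff[OF assms])
  show "{\<omega> \<in> space (Pi\<^sub>M J (\<lambda>_. lborel)). L2_set \<omega> J = 1} \<in> sets (Pi\<^sub>M J (\<lambda>_. lborel :: real measure))"
    by measurable
  have "L2_set (\<lambda>j\<in>J. y j / L2_set y J) J = 1" if "0 < L2_set y J" for y :: "'a \<Rightarrow> real"
  proof -
    have "L2_set (\<lambda>j\<in>J. y j / L2_set y J) J = L2_set (\<lambda>j. (1 / L2_set y J) * y j) J"
      by (intro L2_set_cong) auto
    also have "\<dots> = (1 / L2_set y J) * L2_set y J"
      by (rule L2_set_right_distrib[symmetric]) simp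
    finally show ?thesis using that by simp
  qed
  then show "AE y in Pi\<^sub>M J (\<lambda>_. lborel). 0 < L2_set y J \<and> L2_set y J \<le> 1 \<longrightarrow>
      L2_set (\<lambda>j\<in>J. y j / L2_set y J) J = 1"
    by auto
qed

text \<open>A coordinate hyperplane is a product set with one factor of measure zero.\<close>

lemma AE_PiM_lborel_nonzero:
  assumes "finite J" "j \<in> J"
  shows "AE y in Pi\<^sub>M J (\<lambda>_. lborel :: real measure). y j \<noteq> 0"
proof -
  have "AE y in Pi\<^sub>M J (\<lambda>_. lborel :: real measure). y \<in> space (Pi\<^sub>M J (\<lambda>_. lborel :: real measure)) \<longrightarrow> y j \<noteq> 0"
  proof (rule AE_I)
    let ?N = "Pi\<^sub>E J (\<lambda>i. if i = j then {0} else UNIV) :: ('a \<Rightarrow> real) set"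
    show "{y \<in> space (Pi\<^sub>M J (\<lambda>_. lborel :: real measure)). \<not> (y \<in> space (Pi\<^sub>M J (\<lambda>_. lborel :: real measure)) \<longrightarrow> y j \<noteq> 0)} \<subseteq> ?N"
      by (auto simp: space_PiM PiE_def Pi_def)
    show "?N \<in> sets (Pi\<^sub>M J (\<lambda>_. lborel :: real measure))"
      using assms by (intro sets_PiM_I_finite) auto
    have "emeasure (Pi\<^sub>M J (\<lambda>_. lborel :: real measure)) ?N
        = (\<Prod>i\<in>J. emeasure lborel (if i = j then {0} else UNIV :: real set))"
      using assms by (intro PiL.emeasure_PiM) auto
    also have "\<dots> = 0"
      using assms by (intro prod_zero) auto
    finally show "emeasure (Pi\<^sub>M J (\<lambda>_. lborel :: real measure)) ?N = 0" .
  qed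
  then show ?thesis using AE_space by eventually_elim auto
qed

lemma dunkl_weight_nonneg: "0 \<le> dunkl_weight k J y"
  by (auto simp: dunkl_weight_def intro!: prod_nonneg)

lemma dunkl_weight_pos: "(\<And>j. j \<in> J \<Longrightarrow> y j \<noteq> 0) \<Longrightarrow> 0 < dunkl_weight k J y"
  by (auto simp: dunkl_weight_def intro!: prod_pos)

lemma dunkl_weight_le_1:
  assumes "\<And>j. 0 \<le> k j" "\<And>j. j \<in> J \<Longrightarrow> \<bar>y j\<bar> \<le> 1"
  shows "dunkl_weight k J y \<le> 1"
proof -
  have "\<bar>y j\<bar> powr (2 * k j) \<le> 1" if "j \<in> J" for j
    using powr_mono2[of "2 * k j" "\<bar>y j\<bar>" 1] assms that by auto
  then show ?thesis
    unfolding dunkl_weight_def by (intro prod_le_1) auto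
qed

lemma AE_sphere_measure_dunkl_weight_pos:
  assumes "finite J" "J \<noteq> {}"
  shows "AE \<omega> in sphere_measure J. 0 < dunkl_weight k J \<omega>"
proof (subst AE_sphere_measure_iff[OF assms])
  show "{\<omega> \<in> space (Pi\<^sub>M J (\<lambda>_. lborel)). 0 < dunkl_weight k J \<omega>} \<in> sets (Pi\<^sub>M J (\<lambda>_. lborel :: real measure))"
    by measurable
  have "AE y in Pi\<^sub>M J (\<lambda>_. lborel :: real measure). \<forall>j\<in>J. y j \<noteq> 0"
    using assms by (intro AE_finite_allI AE_PiM_lborel_nonzero)
  then show "AE y in Pi\<^sub>M J (\<lambda>_. lborel). 0 < L2_set y J \<and> L2_set y J \<le> 1 \<longrightarrow>
      0 < dunkl_weight k J (\<lambda>j\<in>J. y j / L2_set y J)"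
    by eventually_elim (auto intro!: dunkl_weight_pos)
qed

text \<open>The weight is positive off the coordinate hyperplanes, so the weighted and the
  unweighted surface measure have the same null sets. Arguments about null sets can therefore forget
  \<open>k\<close>.\<close>

lemma AE_dunkl_sphere_measure_iff:
  assumes "finite J" "J \<noteq> {}"
  shows "(AE \<omega> in dunkl_sphere_measure k J. P \<omega>) \<longleftrightarrow> (AE \<omega> in sphere_measure J. P \<omega>)"
proof -
  have "(AE \<omega> in dunkl_sphere_measure k J. P \<omega>) \<longleftrightarrow>
      (AE \<omega> in sphere_measure J. 0 < dunkl_weight k J \<omega> \<longrightarrow> P \<omega>)"
    unfolding dunkl_sphere_measure_def by (subst AE_density) auto
  also have "\<dots> \<longleftrightarrow> (AE \<omega> in sphere_measure J. P \<omega>)"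
    using AE_sphere_measure_dunkl_weight_pos[OF assms, of k] by (auto elim: eventually_elim2)
  finally show ?thesis .
qed

text \<open>Coordinates of a unit vector are at most \<open>1\<close> in modulus and
  \<open>k\<close> is non-negative, so the weight is at most \<open>1\<close> on the sphere.\<close>

lemma finite_measure_dunkl_sphere_measure:
  assumes "finite J" "J \<noteq> {}" "\<And>j. 0 \<le> k j"
  shows "finite_measure (dunkl_sphere_measure k J)"
proof
  have "AE \<omega> in sphere_measure J. dunkl_weight k J \<omega> \<le> 1"
    using AE_sphere_measure_L2_set[OF assms(1,2)]
  proof eventually_elim
    case (elim \<omega>)
    have "\<bar>\<omega> j\<bar> \<le> 1" if "j \<in> J" for j
    proof -
      have "L2_set \<omega> J = L2_set (\<lambda>j. \<bar>\<omega> j\<bar>) J"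
        by (simp add: L2_set_def)
      then show ?thesis
        using member_le_L2_set[OF assms(1) that, of "\<lambda>j. \<bar>\<omega> j\<bar>"] elim by auto
    qed
    then show ?case using assms(3) by (intro dunkl_weight_le_1)
  qed
  then have "(\<integral>\<^sup>+\<omega>. ennreal (dunkl_weight k J \<omega>) \<partial>sphere_measure J) \<le> (\<integral>\<^sup>+\<omega>. 1 \<partial>sphere_measure J)"
    by (intro nn_integral_mono_AE) (auto elim: eventually_mono)
  also have "\<dots> < \<infinity>"
    using emeasure_sphere_measure_finite[OF assms(1)] by simp
  finally have "(\<integral>\<^sup>+\<omega>. ennreal (dunkl_weight k J \<omega>) \<partial>sphere_measure J) < \<infinity>" .
  then show "emeasure (dunkl_sphere_measure k J) (space (dunkl_sphere_measure k J)) \<noteq> \<infinity>"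
  proof -
    have "emeasure (dunkl_sphere_measure k J) (space (dunkl_sphere_measure k J))
        = (\<integral>\<^sup>+\<omega>. ennreal (dunkl_weight k J \<omega>) * indicator (space (sphere_measure J)) \<omega> \<partial>sphere_measure J)"
      unfolding dunkl_sphere_measure_def space_density by (rule emeasure_density) (simp, rule sets.top)
    also have "\<dots> = (\<integral>\<^sup>+\<omega>. ennreal (dunkl_weight k J \<omega>) \<partial>sphere_measure J)"
      by (intro nn_integral_cong) (simp del: space_sphere_measure)
    finally show ?thesis
      using \<open>(\<integral>\<^sup>+\<omega>. ennreal (dunkl_weight k J \<omega>) \<partial>sphere_measure J) < \<infinity>\<close> by simp
  qed
qed

text \<open>Absorbs the weight and the restriction to positive radii into a measure, so that the
  radial part of \<open>block_norm\<close> is an \<open>Lp_norm\<close> to which Minkowski's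
  inequality applies.\<close>

definition radial_measure :: "('n \<Rightarrow> real) \<Rightarrow> 'n set \<Rightarrow> real measure" where
  "radial_measure k J = density lborel (\<lambda>\<rho>. ennreal (indicator {0<..} \<rho> * \<rho> powr (dunkl_dim k J - 1)))"

lemma sets_radial_measure [measurable_cong, simp]: "sets (radial_measure k J) = sets borel"
  by (simp add: radial_measure_def)

lemma space_radial_measure [simp]: "space (radial_measure k J) = UNIV"
  by (simp add: radial_measure_def)

lemma sigma_finite_radial_measure: "sigma_finite_measure (radial_measure k J)"
  unfolding radial_measure_def
  by (subst sigma_finite_measure.sigma_finite_iff_density_finite[OF sigma_finite_lborel]) auto

lemma AE_radial_measure_iff:
  "(AE \<rho> in radial_measure k J. P \<rho>) \<longleftrightarrow> (AE \<rho> in lborel. 0 < \<rho> \<longrightarrow> P \<rho>)"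
  unfolding radial_measure_def
  by (subst AE_density) (auto simp: indicator_def intro!: arg_cong[where f = "\<lambda>P. almost_everywhere lborel P"])

section \<open>Iterated norms\<close>

lemma block_norm_mono:
  assumes "0 < p" "0 < q" "\<And>x. F x \<le> G x"
  shows "block_norm k J p q F x \<le> block_norm k J p q G x"
  unfolding block_norm_def using assms
  by (intro enn_powr_mono nn_integral_mono mult_right_mono) auto

lemma block_norm_cong_AE:
  assumes "AE \<rho> in lborel. 0 < \<rho> \<longrightarrow>
    (AE \<omega> in dunkl_sphere_measure k J. F (set_block J x \<rho> \<omega>) = G (set_block J x \<rho> \<omega>))"
  shows "block_norm k J p q F x = block_norm k J p q G x"
proof -
  have "AE \<rho> in lborel.
      enn_powr (\<integral>\<^sup>+\<omega>. enn_powr (F (set_block J x \<rho> \<omega>)) q \<partial>dunkl_sphere_measure k J) (p / q)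
          * ennreal (\<rho> powr (dunkl_dim k J - 1)) * indicator {0<..} \<rho> =
      enn_powr (\<integral>\<^sup>+\<omega>. enn_powr (G (set_block J x \<rho> \<omega>)) q \<partial>dunkl_sphere_measure k J) (p / q)
          * ennreal (\<rho> powr (dunkl_dim k J - 1)) * indicator {0<..} \<rho>"
    using assms
  proof eventually_elim
    case (elim \<rho>)
    show ?case
    proof (cases "0 < \<rho>")
      case True
      with elim have "AE \<omega> in dunkl_sphere_measure k J. enn_powr (F (set_block J x \<rho> \<omega>)) q = enn_powr (G (set_block J x \<rho> \<omega>)) q"
        by (auto elim!: eventually_mono)
      then show ?thesis by (simp cong: nn_integral_cong_AE)
    qed simp
  qed
  then show ?thesis
    unfolding block_norm_def by (simp cong: nn_integral_cong_AE)
qed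

text \<open>The equation \<open>range_b\<close> says two things: every coordinate belongs to one of
  the blocks \<open>1\<close> to \<open>m\<close>, and none of these blocks is empty.\<close>

locale dunkl_blocks =
  fixes b :: "'n::finite \<Rightarrow> nat" and k :: "'n \<Rightarrow> real" and m :: nat and p q :: "nat \<Rightarrow> real"
  assumes k_nonneg: "0 \<le> k j"
    and range_b: "range b = {1..m}"
    and p_gt_1: "i \<in> {1..m} \<Longrightarrow> 1 < p i"
    and q_gt_1: "i \<in> {1..m} \<Longrightarrow> 1 < q i"
begin

lemma block_nonempty: "i \<in> {1..m} \<Longrightarrow> block b i \<noteq> {}"
  unfolding range_b[symmetric] by (auto simp: block_def)

lemma sigma_finite_sphere:
  "J \<noteq> {} \<Longrightarrow> sigma_finite_measure (dunkl_sphere_measure k J)"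
  by (intro finite_measure.axioms(1) finite_measure_dunkl_sphere_measure)
     (simp_all add: k_nonneg)

text \<open>The parameter \<open>z\<close> serves two purposes: it is the variable of integration
  when Minkowski's inequality is applied, and it ranges over \<open>unit\<close> when a single
  function is meant. Measurability has to be joint because the result is integrated again in \<rho>
  and, later, in the remaining coordinates.\<close>

lemma measurable_inner_norm:
  assumes J: "J \<noteq> {}" and F: "case_prod F \<in> borel_measurable (N \<Otimes>\<^sub>M borel)"
  shows "(\<lambda>((z, x), \<rho>). Lp_norm (dunkl_sphere_measure k J) q' (\<lambda>\<omega>. F z (set_block J x \<rho> \<omega>)))
    \<in> borel_measurable ((N \<Otimes>\<^sub>M (borel :: (real ^ 'n) measure)) \<Otimes>\<^sub>M (borel :: real measure))"
proof -
  have [measurable]: "(\<lambda>w. snd w) \<in> (((N \<Otimes>\<^sub>M (borel :: (real ^ 'n) measure)) \<Otimes>\<^sub>M (borel :: real measure)) \<Otimes>\<^sub>M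
      dunkl_sphere_measure k J) \<rightarrow>\<^sub>M Pi\<^sub>M J (\<lambda>_. lborel)"
    by measurable
  have "(\<lambda>w. set_block J (snd (fst (fst w))) (snd (fst w)) (snd w))
    \<in> borel_measurable (((N \<Otimes>\<^sub>M (borel :: (real ^ 'n) measure)) \<Otimes>\<^sub>M (borel :: real measure)) \<Otimes>\<^sub>M
      dunkl_sphere_measure k J)"
    by measurable
  then have "(\<lambda>w. (fst (fst (fst w)), set_block J (snd (fst (fst w))) (snd (fst w)) (snd w)))
    \<in> ((N \<Otimes>\<^sub>M (borel :: (real ^ 'n) measure)) \<Otimes>\<^sub>M (borel :: real measure)) \<Otimes>\<^sub>M
      dunkl_sphere_measure k J \<rightarrow>\<^sub>M N \<Otimes>\<^sub>M borel"
    by (intro measurable_Pair) measurable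
  from measurable_compose[OF this F]
  have "(\<lambda>w. F (fst (fst (fst w))) (set_block J (snd (fst (fst w))) (snd (fst w)) (snd w)))
    \<in> borel_measurable (((N \<Otimes>\<^sub>M (borel :: (real ^ 'n) measure)) \<Otimes>\<^sub>M (borel :: real measure)) \<Otimes>\<^sub>M
      dunkl_sphere_measure k J)"
    by simp
  then show ?thesis
    unfolding case_prod_beta
    by (intro measurable_Lp_norm sigma_finite_sphere[OF J]) (simp add: case_prod_beta)
qed

text \<open>The exponent \<open>p' / q'\<close> is the outer root \<open>1 / q'\<close> followed by
  the power \<open>p'\<close>, which exhibits the block norm as two nested Lebesgue norms.\<close>

lemma block_norm_eq:
  assumes J: "J \<noteq> {}" and F: "F \<in> borel_measurable borel" and q: "0 < q'"
  shows "block_norm k J p' q' F x = Lp_norm (radial_measure k J) p'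
    (\<lambda>\<rho>. Lp_norm (dunkl_sphere_measure k J) q' (\<lambda>\<omega>. F (set_block J x \<rho> \<omega>)))"
proof -
  let ?I = "\<lambda>\<rho>. Lp_norm (dunkl_sphere_measure k J) q' (\<lambda>\<omega>. F (set_block J x \<rho> \<omega>))"
  have F': "(\<lambda>(z::unit, x). F x) \<in> borel_measurable (count_space UNIV \<Otimes>\<^sub>M borel)"
    using F by simp
  have [measurable]: "?I \<in> borel_measurable borel"
    using measurable_Pair2[OF measurable_inner_norm[OF J F', of q'], of "((), x)"] by (simp add: space_pair_measure)
  have "(\<integral>\<^sup>+\<rho>. enn_powr (?I \<rho>) p' \<partial>radial_measure k J)
      = (\<integral>\<^sup>+\<rho>. ennreal (indicator {0<..} \<rho> * \<rho> powr (dunkl_dim k J - 1)) * enn_powr (?I \<rho>) p' \<partial>lborel)"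
    unfolding radial_measure_def by (rule nn_integral_density) measurable
  also have "\<dots> = (\<integral>\<^sup>+\<rho>\<in>{0<..}.
          enn_powr (\<integral>\<^sup>+\<omega>. enn_powr (F (set_block J x \<rho> \<omega>)) q' \<partial>dunkl_sphere_measure k J) (p' / q')
            * ennreal (\<rho> powr (dunkl_dim k J - 1)) \<partial>lborel)"
    by (intro nn_integral_cong) (auto simp: indicator_def Lp_norm_def enn_powr_powr mult.commute)
  finally show ?thesis
    by (simp add: block_norm_def Lp_norm_def[of "radial_measure k J"])
qed

lemma measurable_block_norm:
  assumes J: "J \<noteq> {}" and F: "case_prod F \<in> borel_measurable (N \<Otimes>\<^sub>M borel)" and q: "0 < q'"
  shows "(\<lambda>(z, x). block_norm k J p' q' (F z) x) \<in> borel_measurable (N \<Otimes>\<^sub>M borel)"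
proof -
  have Fz: "F z \<in> borel_measurable borel" if "z \<in> space N" for z
    using measurable_Pair2[OF F that] by simp
  have "(\<lambda>w. Lp_norm (radial_measure k J) p'
      (\<lambda>\<rho>. Lp_norm (dunkl_sphere_measure k J) q' (\<lambda>\<omega>. F (fst w) (set_block J (snd w) \<rho> \<omega>))))
    \<in> borel_measurable (N \<Otimes>\<^sub>M borel)"
  proof (intro measurable_Lp_norm sigma_finite_radial_measure)
    have "(\<lambda>(w, \<rho>). Lp_norm (dunkl_sphere_measure k J) q' (\<lambda>\<omega>. F (fst w) (set_block J (snd w) \<rho> \<omega>)))
        \<in> borel_measurable ((N \<Otimes>\<^sub>M borel) \<Otimes>\<^sub>M borel)"
      using measurable_inner_norm[OF J F, of q'] by (simp add: case_prod_unfold)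
    then show "(\<lambda>(w, \<rho>). Lp_norm (dunkl_sphere_measure k J) q' (\<lambda>\<omega>. F (fst w) (set_block J (snd w) \<rho> \<omega>)))
        \<in> borel_measurable ((N \<Otimes>\<^sub>M borel) \<Otimes>\<^sub>M radial_measure k J)"
      by (simp cong: measurable_cong_sets)
  qed
  then show ?thesis
    by (rule measurable_cong[THEN iffD1, rotated]) (auto simp: space_pair_measure block_norm_eq[OF J Fz q])
qed

lemma measurable_iterated_norm_param:
  assumes "i \<le> m" and F: "case_prod F \<in> borel_measurable (N \<Otimes>\<^sub>M borel)"
  shows "(\<lambda>(z, x). iterated_norm b k p q i (F z) x) \<in> borel_measurable (N \<Otimes>\<^sub>M borel)"
  using assms(1)
proof (induction i)
  case 0
  then show ?case using F by simp
next
  case (Suc i)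
  then have "Suc i \<in> {1..m}" by simp
  then show ?case
    using measurable_block_norm[OF block_nonempty[of "Suc i"], of "\<lambda>z. iterated_norm b k p q i (F z)" N]
      Suc q_gt_1[of "Suc i"] by simp
qed

lemma measurable_iterated_norm:
  assumes "i \<le> m" and F: "F \<in> borel_measurable borel"
  shows "iterated_norm b k p q i F \<in> borel_measurable borel"
proof -
  have "(\<lambda>(z::unit, x). F x) \<in> borel_measurable (count_space UNIV \<Otimes>\<^sub>M borel)"
    using F by simp
  from measurable_Pair2[OF measurable_iterated_norm_param[OF assms(1) this], of "()"]
  show ?thesis by simp
qed

lemma pq_pos:
  assumes "Suc i \<le> m"
  shows "0 < p (Suc i)" "0 < q (Suc i)" "1 \<le> p (Suc i)" "1 \<le> q (Suc i)" "block b (Suc i) \<noteq> {}"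
  using assms p_gt_1[of "Suc i"] q_gt_1[of "Suc i"] block_nonempty[of "Suc i"] by auto

lemma iterated_norm_mono:
  assumes "i \<le> m" "\<And>x. F x \<le> G x"
  shows "iterated_norm b k p q i F x \<le> iterated_norm b k p q i G x"
  using assms(1)
proof (induction i arbitrary: x)
  case (Suc i)
  then show ?case
    using pq_pos[of i] by (auto intro!: block_norm_mono)
qed (simp add: assms)

lemma block_norm_cmult:
  assumes "J \<noteq> {}" "F \<in> borel_measurable borel" "0 < p'" "0 < q'"
  shows "block_norm k J p' q' (\<lambda>x. c * F x) x = c * block_norm k J p' q' F x"
proof -
  have F': "(\<lambda>(z::unit, x). F x) \<in> borel_measurable (count_space UNIV \<Otimes>\<^sub>M borel)"
    using assms by simp
  have [measurable]: "(\<lambda>\<rho>. Lp_norm (dunkl_sphere_measure k J) q' (\<lambda>\<omega>. F (set_block J x \<rho> \<omega>))) \<in> borel_measurable borel"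
    using measurable_Pair2[OF measurable_inner_norm[OF assms(1) F', of q'], of "((), x)"] by (simp add: space_pair_measure)
  have "(\<lambda>\<omega>. set_block J x \<rho> \<omega>) \<in> borel_measurable (dunkl_sphere_measure k J)" for \<rho>
    by measurable
  note [measurable] = measurable_compose[OF this assms(2)]
  show ?thesis
    using assms by (simp add: block_norm_eq Lp_norm_cmult)
qed

lemma iterated_norm_cmult:
  assumes "i \<le> m" "F \<in> borel_measurable borel"
  shows "iterated_norm b k p q i (\<lambda>x. c * F x) x = c * iterated_norm b k p q i F x"
  using assms(1)
proof (induction i arbitrary: x)
  case (Suc i)
  then have "iterated_norm b k p q i (\<lambda>x. c * F x) = (\<lambda>x. c * iterated_norm b k p q i F x)"
    by auto
  then show ?case
    using pq_pos[of i] Suc.prems assms(2)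
    by (simp add: block_norm_cmult measurable_iterated_norm)
qed simp

text \<open>Minkowski's inequality is used once on the sphere and, by monotonicity of the radial
  norm, once more on the radii.\<close>

lemma block_norm_Minkowski:
  assumes J: "J \<noteq> {}" and M: "sigma_finite_measure M"
    and F: "case_prod F \<in> borel_measurable (M \<Otimes>\<^sub>M borel)" and pq: "1 \<le> p'" "1 \<le> q'"
  shows "block_norm k J p' q' (\<lambda>x. \<integral>\<^sup>+s. F s x \<partial>M) x \<le> (\<integral>\<^sup>+s. block_norm k J p' q' (F s) x \<partial>M)"
proof -
  interpret M: sigma_finite_measure M by fact
  let ?S = "dunkl_sphere_measure k J"
  have F': "(\<lambda>(x, s). F s x) \<in> borel_measurable (borel \<Otimes>\<^sub>M M)"
    using measurable_compose[OF measurable_pair_swap' F] by (simp add: case_prod_beta)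
  have meas: "(\<lambda>x. \<integral>\<^sup>+s. F s x \<partial>M) \<in> borel_measurable borel"
    using F' by (rule M.borel_measurable_nn_integral)
  have Fs: "F s \<in> borel_measurable borel" if "s \<in> space M" for s
    using measurable_Pair2[OF F that] by simp
  have inner: "Lp_norm ?S q' (\<lambda>\<omega>. \<integral>\<^sup>+s. F s (set_block J x \<rho> \<omega>) \<partial>M)
      \<le> (\<integral>\<^sup>+s. Lp_norm ?S q' (\<lambda>\<omega>. F s (set_block J x \<rho> \<omega>)) \<partial>M)" for \<rho>
  proof (rule Minkowski_integral_inequality[OF M sigma_finite_sphere[OF J] pq(2)])
    have "(\<lambda>w. (fst w, set_block J x \<rho> (snd w))) \<in> M \<Otimes>\<^sub>M ?S \<rightarrow>\<^sub>M M \<Otimes>\<^sub>M borel"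
      by measurable
    from measurable_compose[OF this F]
    show "(\<lambda>(s, \<omega>). F s (set_block J x \<rho> \<omega>)) \<in> borel_measurable (M \<Otimes>\<^sub>M ?S)"
      by (simp add: case_prod_beta)
  qed
  have "block_norm k J p' q' (\<lambda>x. \<integral>\<^sup>+s. F s x \<partial>M) x
      = Lp_norm (radial_measure k J) p' (\<lambda>\<rho>. Lp_norm ?S q' (\<lambda>\<omega>. \<integral>\<^sup>+s. F s (set_block J x \<rho> \<omega>) \<partial>M))"
    using pq by (subst block_norm_eq[OF J meas]) auto
  also have "\<dots> \<le> Lp_norm (radial_measure k J) p' (\<lambda>\<rho>. \<integral>\<^sup>+s. Lp_norm ?S q' (\<lambda>\<omega>. F s (set_block J x \<rho> \<omega>)) \<partial>M)"
    using pq inner by (intro Lp_norm_mono_AE) auto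
  also have "\<dots> \<le> (\<integral>\<^sup>+s. Lp_norm (radial_measure k J) p' (\<lambda>\<rho>. Lp_norm ?S q' (\<lambda>\<omega>. F s (set_block J x \<rho> \<omega>))) \<partial>M)"
  proof (rule Minkowski_integral_inequality[OF M sigma_finite_radial_measure pq(1)])
    have "(\<lambda>w. ((fst w, x), snd w)) \<in> M \<Otimes>\<^sub>M radial_measure k J \<rightarrow>\<^sub>M (M \<Otimes>\<^sub>M borel) \<Otimes>\<^sub>M borel"
      by measurable
    from measurable_compose[OF this measurable_inner_norm[OF J F, of q']]
    show "(\<lambda>(s, \<rho>). Lp_norm ?S q' (\<lambda>\<omega>. F s (set_block J x \<rho> \<omega>))) \<in> borel_measurable (M \<Otimes>\<^sub>M radial_measure k J)"
      by (simp add: case_prod_beta)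
  qed
  also have "\<dots> = (\<integral>\<^sup>+s. block_norm k J p' q' (F s) x \<partial>M)"
    using pq by (intro nn_integral_cong) (simp add: block_norm_eq[OF J Fs])
  finally show ?thesis .
qed

lemma iterated_norm_Minkowski:
  assumes "i \<le> m" and M: "sigma_finite_measure M"
    and F: "case_prod F \<in> borel_measurable (M \<Otimes>\<^sub>M borel)"
  shows "iterated_norm b k p q i (\<lambda>x. \<integral>\<^sup>+s. F s x \<partial>M) x \<le> (\<integral>\<^sup>+s. iterated_norm b k p q i (F s) x \<partial>M)"
  using assms(1)
proof (induction i arbitrary: x)
  case (Suc i)
  then have IH: "iterated_norm b k p q i (\<lambda>x. \<integral>\<^sup>+s. F s x \<partial>M) x \<le> (\<integral>\<^sup>+s. iterated_norm b k p q i (F s) x \<partial>M)" for x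
    by simp
  have "iterated_norm b k p q (Suc i) (\<lambda>x. \<integral>\<^sup>+s. F s x \<partial>M) x
      \<le> block_norm k (block b (Suc i)) (p (Suc i)) (q (Suc i)) (\<lambda>x. \<integral>\<^sup>+s. iterated_norm b k p q i (F s) x \<partial>M) x"
    using pq_pos[of i] Suc.prems IH by (auto intro!: block_norm_mono)
  also have "\<dots> \<le> (\<integral>\<^sup>+s. iterated_norm b k p q (Suc i) (F s) x \<partial>M)"
    using pq_pos[of i] Suc.prems measurable_iterated_norm_param[OF _ F, of i]
      block_norm_Minkowski[OF _ M, of "block b (Suc i)" "\<lambda>s. iterated_norm b k p q i (F s)"] by simp
  finally show ?case .
qed simp

section \<open>Behaviour of the norms under dilations\<close>

lemma set_block_scaleR: "t *\<^sub>R set_block J x \<rho> \<omega> = set_block J (t *\<^sub>R x) (t * \<rho>) \<omega>"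
  by (simp add: set_block_def vec_eq_iff mult.assoc)

text \<open>Only the radius of the block \<open>J\<close> is substituted; directions are unaffected.
  The remaining coordinates are not integrated here and keep their factor \<open>t\<close>, hence
  the evaluation at \<open>t *\<^sub>R x\<close> on the right.\<close>

lemma block_norm_scale:
  assumes J: "J \<noteq> {}" and F: "F \<in> borel_measurable borel" and "0 < p'" "0 < q'" and t: "0 < t"
  shows "block_norm k J p' q' (\<lambda>x. F (t *\<^sub>R x)) x
    = ennreal (t powr (- dunkl_dim k J / p')) * block_norm k J p' q' F (t *\<^sub>R x)"
proof -
  let ?N = "dunkl_dim k J"
  let ?I = "\<lambda>\<rho>. enn_powr (\<integral>\<^sup>+\<omega>. enn_powr (F (set_block J (t *\<^sub>R x) \<rho> \<omega>)) q' \<partial>dunkl_sphere_measure k J) (p' / q')"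
  let ?h = "\<lambda>\<rho>. ?I \<rho> * ennreal (\<rho> powr (?N - 1)) * indicator {0<..} \<rho>"
  have F': "(\<lambda>(z::unit, x). F x) \<in> borel_measurable (count_space UNIV \<Otimes>\<^sub>M borel)"
    using F by simp
  have "(\<lambda>\<rho>. Lp_norm (dunkl_sphere_measure k J) q' (\<lambda>\<omega>. F (set_block J (t *\<^sub>R x) \<rho> \<omega>))) \<in> borel_measurable borel"
    using measurable_Pair2[OF measurable_inner_norm[OF J F', of q'], of "((), t *\<^sub>R x)"] by (simp add: space_pair_measure)
  then have "(\<lambda>\<rho>. enn_powr (Lp_norm (dunkl_sphere_measure k J) q' (\<lambda>\<omega>. F (set_block J (t *\<^sub>R x) \<rho> \<omega>))) p') \<in> borel_measurable borel"
    by measurable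
  then have [measurable]: "?I \<in> borel_measurable borel"
    by (simp add: Lp_norm_def enn_powr_powr)
  \<comment> \<open>Substituting \<open>t * \<rho>\<close> for \<rho> yields one factor
    \<open>t\<close> from the differential and \<open>dunkl_dim k J - 1\<close> from the weight; the
    root \<open>1 / p'\<close> is taken afterwards.\<close>
  have "(\<integral>\<^sup>+\<rho>. ?h \<rho> \<partial>lborel) = ennreal \<bar>t\<bar> * (\<integral>\<^sup>+\<rho>. ?h (0 + t * \<rho>) \<partial>lborel)"
    using t by (intro nn_integral_real_affine) auto
  also have "(\<integral>\<^sup>+\<rho>. ?h (0 + t * \<rho>) \<partial>lborel)
      = (\<integral>\<^sup>+\<rho>. ennreal (t powr (?N - 1)) * (?I (t * \<rho>) * ennreal (\<rho> powr (?N - 1)) * indicator {0<..} \<rho>) \<partial>lborel)"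
    using t by (intro nn_integral_cong)
      (auto simp: indicator_def powr_mult ennreal_mult zero_less_mult_iff mult_ac)
  also have "\<dots> = ennreal (t powr (?N - 1)) * (\<integral>\<^sup>+\<rho>\<in>{0<..}. ?I (t * \<rho>) * ennreal (\<rho> powr (?N - 1)) \<partial>lborel)"
    by (rule nn_integral_cmult) measurable
  also have "ennreal \<bar>t\<bar> * \<dots> = ennreal (t powr ?N) * (\<integral>\<^sup>+\<rho>\<in>{0<..}. ?I (t * \<rho>) * ennreal (\<rho> powr (?N - 1)) \<partial>lborel)"
    using t by (simp add: mult.assoc[symmetric] ennreal_mult[symmetric] powr_diff)
  finally have eq: "(\<integral>\<^sup>+\<rho>. ?h \<rho> \<partial>lborel) = ennreal (t powr ?N) * (\<integral>\<^sup>+\<rho>\<in>{0<..}. ?I (t * \<rho>) * ennreal (\<rho> powr (?N - 1)) \<partial>lborel)" .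
  have "ennreal (t powr (- ?N / p')) * block_norm k J p' q' F (t *\<^sub>R x)
     = ennreal (t powr (- ?N / p')) * enn_powr (\<integral>\<^sup>+\<rho>. ?h \<rho> \<partial>lborel) (1 / p')"
    by (simp add: block_norm_def)
  also have "\<dots> = (ennreal (t powr (- ?N / p')) * ennreal (t powr (?N / p'))) *
      enn_powr (\<integral>\<^sup>+\<rho>\<in>{0<..}. ?I (t * \<rho>) * ennreal (\<rho> powr (?N - 1)) \<partial>lborel) (1 / p')"
    unfolding eq by (simp add: enn_powr_mult powr_powr mult.assoc)
  also have "ennreal (t powr (- ?N / p')) * ennreal (t powr (?N / p')) = 1"
    using t by (simp add: ennreal_mult[symmetric] powr_add[symmetric])
  also have "1 * enn_powr (\<integral>\<^sup>+\<rho>\<in>{0<..}. ?I (t * \<rho>) * ennreal (\<rho> powr (?N - 1)) \<partial>lborel) (1 / p')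
     = block_norm k J p' q' (\<lambda>x. F (t *\<^sub>R x)) x"
    by (simp add: block_norm_def set_block_scaleR)
  finally show ?thesis ..
qed

lemma iterated_norm_scale:
  assumes "i \<le> m" and F: "F \<in> borel_measurable borel" and t: "0 < t"
  shows "iterated_norm b k p q i (\<lambda>x. F (t *\<^sub>R x)) x
    = ennreal (t powr (- (\<Sum>j=1..i. dunkl_dim k (block b j) / p j))) * iterated_norm b k p q i F (t *\<^sub>R x)"
  using assms(1)
proof (induction i arbitrary: x)
  case 0
  then show ?case using t by simp
next
  case (Suc i)
  let ?c = "ennreal (t powr (- (\<Sum>j=1..i. dunkl_dim k (block b j) / p j)))"
  have meas: "iterated_norm b k p q i F \<in> borel_measurable borel"
    using Suc.prems F by (intro measurable_iterated_norm) auto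
  have meas': "(\<lambda>x. iterated_norm b k p q i F (t *\<^sub>R x)) \<in> borel_measurable borel"
    by (rule measurable_compose[OF _ meas]) simp
  have "iterated_norm b k p q i (\<lambda>x. F (t *\<^sub>R x)) = (\<lambda>x. ?c * iterated_norm b k p q i F (t *\<^sub>R x))"
    using Suc by auto
  then have "iterated_norm b k p q (Suc i) (\<lambda>x. F (t *\<^sub>R x)) x
     = block_norm k (block b (Suc i)) (p (Suc i)) (q (Suc i)) (\<lambda>x. ?c * iterated_norm b k p q i F (t *\<^sub>R x)) x"
    by simp
  also have "\<dots> = ?c * (ennreal (t powr (- dunkl_dim k (block b (Suc i)) / p (Suc i))) * iterated_norm b k p q (Suc i) F (t *\<^sub>R x))"
    using pq_pos[of i] Suc.prems t meas meas' by (simp add: block_norm_cmult block_norm_scale)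
  also have "\<dots> = ennreal (t powr (- (\<Sum>j=1..Suc i. dunkl_dim k (block b j) / p j))) * iterated_norm b k p q (Suc i) F (t *\<^sub>R x)"
    by (simp add: mult.assoc[symmetric] ennreal_mult[symmetric] powr_add[symmetric])
  finally show ?case .
qed

end

section \<open>Null sets\<close>

lemma AE_lborel_scaleR_iff:
  fixes P :: "'a::euclidean_space \<Rightarrow> bool"
  assumes c: "c \<noteq> 0" and P: "{x. P x} \<in> sets borel"
  shows "(AE x in lborel. P (c *\<^sub>R x)) \<longleftrightarrow> (AE x in lborel. P x)"
proof -
  have "(AE x in lborel. P x) \<longleftrightarrow> (AE x in distr lborel borel (\<lambda>x. 0 + c *\<^sub>R x). P x)"
    using c by (subst lborel_affine[OF c, of 0], subst AE_density) auto
  also have "\<dots> \<longleftrightarrow> (AE x in lborel. P (0 + c *\<^sub>R x))"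
    using P by (subst AE_distr_iff) auto
  finally show ?thesis by simp
qed

lemma measurable_PiM_lborel_scale [measurable (raw)]:
  assumes [measurable]: "r \<in> borel_measurable M" and w: "w \<in> M \<rightarrow>\<^sub>M Pi\<^sub>M J (\<lambda>_. lborel)"
  shows "(\<lambda>z. \<lambda>j\<in>J. r z * w z j) \<in> M \<rightarrow>\<^sub>M Pi\<^sub>M J (\<lambda>_. lborel :: real measure)"
proof (rule measurable_restrict)
  fix j assume "j \<in> J"
  note measurable_compose[OF w measurable_PiM_lborel_component[OF this], measurable]
  have "(\<lambda>z. r z * w z j) \<in> borel_measurable M"
    by measurable
  then show "(\<lambda>z. r z * w z j) \<in> M \<rightarrow>\<^sub>M lborel" by simp
qed

text \<open>The Jacobian \<open>\<bar>c\<bar> ^ card J\<close> splits into one factor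
  \<open>\<bar>c\<bar>\<close> per coordinate, so on product sets the claim reduces to the
  one-dimensional dilation.\<close>

lemma PiM_lborel_scale:
  fixes c :: real
  assumes J: "finite J" and c: "c \<noteq> 0"
  shows "scale_measure (ennreal (\<bar>c\<bar> ^ card J)) (distr (Pi\<^sub>M J (\<lambda>_. lborel)) (Pi\<^sub>M J (\<lambda>_. lborel)) (\<lambda>y. \<lambda>j\<in>J. c * y j))
    = Pi\<^sub>M J (\<lambda>_. lborel)" (is "?M = ?L")
proof (rule PiL.PiM_eqI[OF J])
  show "sets ?M = sets ?L" by simp
  fix A :: "'a \<Rightarrow> real set"
  assume A: "\<And>i. i \<in> J \<Longrightarrow> A i \<in> sets lborel"
  have vim: "(*) c -` A i \<in> sets lborel" if "i \<in> J" for i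
    using measurable_sets[of "(*) c" borel borel "A i"] A[OF that] by simp
  have "emeasure (distr ?L ?L (\<lambda>y. \<lambda>j\<in>J. c * y j)) (Pi\<^sub>E J A)
      = emeasure ?L ((\<lambda>y. \<lambda>j\<in>J. c * y j) -` Pi\<^sub>E J A \<inter> space ?L)"
    using A J by (intro emeasure_distr) (auto intro!: sets_PiM_I_finite)
  also have "(\<lambda>y. \<lambda>j\<in>J. c * y j) -` Pi\<^sub>E J A \<inter> space ?L = Pi\<^sub>E J (\<lambda>i. (*) c -` A i)"
    by (auto simp: space_PiM PiE_def Pi_def extensional_def)
  also have "emeasure ?L \<dots> = (\<Prod>i\<in>J. emeasure lborel ((*) c -` A i))"
    using vim J by (intro PiL.emeasure_PiM) auto
  finally have "emeasure ?M (Pi\<^sub>E J A) = ennreal (\<bar>c\<bar> ^ card J) * (\<Prod>i\<in>J. emeasure lborel ((*) c -` A i))"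
    by (simp only: emeasure_scale_measure)
  also have "\<dots> = (\<Prod>i\<in>J. ennreal \<bar>c\<bar> * emeasure lborel ((*) c -` A i))"
    by (simp add: prod.distrib ennreal_power)
  also have "\<dots> = (\<Prod>i\<in>J. emeasure lborel (A i))"
  proof (intro prod.cong refl)
    fix i assume i: "i \<in> J"
    have "emeasure lborel (A i) = emeasure (density (distr lborel borel (\<lambda>x. 0 + c * x)) (\<lambda>_. ennreal \<bar>c\<bar>)) (A i)"
      using lborel_real_affine[OF c, of 0] by simp
    also have "\<dots> = ennreal \<bar>c\<bar> * emeasure (distr lborel borel (\<lambda>x. 0 + c * x)) (A i)"
      using A[OF i] by (subst emeasure_density_const) auto
    also have "emeasure (distr lborel borel (\<lambda>x. 0 + c * x)) (A i) = emeasure lborel ((*) c -` A i)"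
      using A[OF i] by (subst emeasure_distr) auto
    finally show "ennreal \<bar>c\<bar> * emeasure lborel ((*) c -` A i) = emeasure lborel (A i)" ..
  qed
  finally show "emeasure ?M (Pi\<^sub>E J A) = (\<Prod>i\<in>J. emeasure lborel (A i))" .
qed

lemma AE_PiM_lborel_scale_iff:
  fixes c :: real
  assumes J: "finite J" and c: "c \<noteq> 0"
    and P: "{y \<in> space (Pi\<^sub>M J (\<lambda>_. lborel)). P y} \<in> sets (Pi\<^sub>M J (\<lambda>_. lborel))"
  shows "(AE y in Pi\<^sub>M J (\<lambda>_. lborel). P (\<lambda>j\<in>J. c * y j)) \<longleftrightarrow> (AE y in Pi\<^sub>M J (\<lambda>_. lborel). P y)"
proof -
  have "ennreal (\<bar>c\<bar> ^ card J) \<noteq> 0"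
    using c by simp
  then have "(AE y in Pi\<^sub>M J (\<lambda>_. lborel). P y) \<longleftrightarrow>
      (AE y in distr (Pi\<^sub>M J (\<lambda>_. lborel)) (Pi\<^sub>M J (\<lambda>_. lborel)) (\<lambda>y. \<lambda>j\<in>J. c * y j). P y)"
    by (subst PiM_lborel_scale[OF J c, symmetric], subst AE_scale_measure_iff) auto
  also have "\<dots> \<longleftrightarrow> (AE y in Pi\<^sub>M J (\<lambda>_. lborel). P (\<lambda>j\<in>J. c * y j))"
    using P by (subst AE_distr_iff) auto
  finally show ?thesis ..
qed

text \<open>
  Polar coordinates at the level of null sets: both conditions say that for almost all \<open>y\<close> in the
  unit ball and \<open>\<rho> > 0\<close> the point \<open>\<rho> y\<close> satisfies \<open>P\<close>, since \<open>\<rho>\<close> may be rescaled by \<open>\<bar>y\<bar>\<close> for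
  fixed \<open>y\<close>, and \<open>y\<close> by \<open>\<rho>\<close> for fixed \<open>\<rho>\<close>.
\<close>

lemma AE_polar_iff:
  assumes J: "finite J" "J \<noteq> {}"
    and P: "{y \<in> space (Pi\<^sub>M J (\<lambda>_. lborel)). P y} \<in> sets (Pi\<^sub>M J (\<lambda>_. lborel))"
  shows "(AE \<rho> in lborel. 0 < \<rho> \<longrightarrow> (AE \<omega> in sphere_measure J. P (\<lambda>j\<in>J. \<rho> * \<omega> j))) \<longleftrightarrow>
    (AE y in Pi\<^sub>M J (\<lambda>_. lborel). P y)"
proof -
  let ?L = "Pi\<^sub>M J (\<lambda>_. lborel :: real measure)"
  let ?B = "\<lambda>y. 0 < L2_set y J \<and> L2_set y J \<le> 1"
  interpret L: sigma_finite_measure ?L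
    using J(1) by (rule PiL.sigma_finite)
  interpret pair_sigma_finite "lborel :: real measure" ?L ..
  have [measurable]: "Measurable.pred ?L P"
    using P by (simp add: pred_def)
  have [measurable]: "Measurable.pred (borel \<Otimes>\<^sub>M ?L) (\<lambda>z. P (\<lambda>j\<in>J. f (fst z) (snd z) * snd z j))"
    if [measurable]: "(\<lambda>z. f (fst z) (snd z)) \<in> borel_measurable (borel \<Otimes>\<^sub>M ?L)" for f
    by (rule measurable_compose[where f = "\<lambda>z. \<lambda>j\<in>J. f (fst z) (snd z) * snd z j" and N = ?L]) measurable
  have norm_scale: "L2_set (\<lambda>j\<in>J. c * y j) J = c * L2_set y J" if "0 < c" for c :: real and y
  proof -
    have "L2_set (\<lambda>j\<in>J. c * y j) J = L2_set (\<lambda>j. c * y j) J"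
      by (intro L2_set_cong) auto
    then show ?thesis
      using L2_set_right_distrib[of c y J] that by simp
  qed
  have "(AE \<rho> in lborel. 0 < \<rho> \<longrightarrow> (AE \<omega> in sphere_measure J. P (\<lambda>j\<in>J. \<rho> * \<omega> j))) \<longleftrightarrow>
     (AE \<rho> in lborel. AE y in ?L. 0 < \<rho> \<and> ?B y \<longrightarrow> P (\<lambda>j\<in>J. (\<rho> / L2_set y J) * y j))"
  proof (rule arg_cong[where f = "\<lambda>P. almost_everywhere lborel P"], rule ext)
    fix \<rho> :: real
    have "{y \<in> space ?L. P (\<lambda>j\<in>J. \<rho> * y j)} \<in> sets ?L"
      by measurable
    then have "(AE \<omega> in sphere_measure J. P (\<lambda>j\<in>J. \<rho> * \<omega> j)) \<longleftrightarrow>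
        (AE y in ?L. ?B y \<longrightarrow> P (\<lambda>j\<in>J. \<rho> * (\<lambda>j\<in>J. y j / L2_set y J) j))"
      by (rule AE_sphere_measure_iff[OF J])
    moreover have "(\<lambda>j\<in>J. \<rho> * (\<lambda>j\<in>J. y j / L2_set y J) j) = (\<lambda>j\<in>J. (\<rho> / L2_set y J) * y j)" for y :: "'a \<Rightarrow> real"
      by (auto simp: fun_eq_iff)
    ultimately show "(0 < \<rho> \<longrightarrow> (AE \<omega> in sphere_measure J. P (\<lambda>j\<in>J. \<rho> * \<omega> j))) \<longleftrightarrow>
        (AE y in ?L. 0 < \<rho> \<and> ?B y \<longrightarrow> P (\<lambda>j\<in>J. (\<rho> / L2_set y J) * y j))"
      by (cases "0 < \<rho>") (simp_all only: simp_thms, simp)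
  qed
  also have "\<dots> \<longleftrightarrow> (AE y in ?L. AE \<rho> in lborel. 0 < \<rho> \<and> ?B y \<longrightarrow> P (\<lambda>j\<in>J. (\<rho> / L2_set y J) * y j))"
    by (rule AE_commute) measurable
  also have "\<dots> \<longleftrightarrow> (AE y in ?L. AE \<rho> in lborel. 0 < \<rho> \<and> ?B y \<longrightarrow> P (\<lambda>j\<in>J. \<rho> * y j))"
  proof (rule AE_cong)
    fix y assume [measurable]: "y \<in> space ?L"
    show "(AE \<rho> in lborel. 0 < \<rho> \<and> ?B y \<longrightarrow> P (\<lambda>j\<in>J. (\<rho> / L2_set y J) * y j)) \<longleftrightarrow>
      (AE \<rho> in lborel. 0 < \<rho> \<and> ?B y \<longrightarrow> P (\<lambda>j\<in>J. \<rho> * y j))"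
    proof (cases "?B y")
      case True
      have "{\<rho>. 0 < \<rho> \<longrightarrow> P (\<lambda>j\<in>J. \<rho> * y j)} = {\<rho> \<in> space (borel :: real measure). 0 < \<rho> \<longrightarrow> P (\<lambda>j\<in>J. \<rho> * y j)}"
        by simp
      also have "\<dots> \<in> sets borel"
        by measurable
      finally have "{\<rho>. 0 < \<rho> \<longrightarrow> P (\<lambda>j\<in>J. \<rho> * y j)} \<in> sets borel" .
      with True AE_lborel_scaleR_iff[of "1 / L2_set y J" "\<lambda>\<rho>. 0 < \<rho> \<longrightarrow> P (\<lambda>j\<in>J. \<rho> * y j)"]
      show ?thesis by (simp add: zero_less_divide_iff)
    qed auto
  qed
  also have "\<dots> \<longleftrightarrow> (AE \<rho> in lborel. AE y in ?L. 0 < \<rho> \<and> ?B y \<longrightarrow> P (\<lambda>j\<in>J. \<rho> * y j))"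
    by (rule AE_commute[symmetric]) measurable
  also have "\<dots> \<longleftrightarrow> (AE \<rho> in lborel. AE y in ?L. 0 < \<rho> \<and> 0 < L2_set y J \<and> L2_set y J \<le> \<rho> \<longrightarrow> P y)"
  proof (rule AE_cong)
    fix \<rho> :: real
    show "(AE y in ?L. 0 < \<rho> \<and> ?B y \<longrightarrow> P (\<lambda>j\<in>J. \<rho> * y j)) \<longleftrightarrow>
        (AE y in ?L. 0 < \<rho> \<and> 0 < L2_set y J \<and> L2_set y J \<le> \<rho> \<longrightarrow> P y)"
    proof (cases "0 < \<rho>")
      case True
      have "{y \<in> space ?L. 0 < L2_set y J \<and> L2_set y J \<le> \<rho> \<longrightarrow> P y} \<in> sets ?L"
        by measurable
      with True AE_PiM_lborel_scale_iff[OF J(1), of \<rho> "\<lambda>y. 0 < L2_set y J \<and> L2_set y J \<le> \<rho> \<longrightarrow> P y"]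
      show ?thesis by (simp add: norm_scale zero_less_mult_iff)
    qed simp
  qed
  also have "\<dots> \<longleftrightarrow> (AE y in ?L. AE \<rho> in lborel. 0 < \<rho> \<and> 0 < L2_set y J \<and> L2_set y J \<le> \<rho> \<longrightarrow> P y)"
    by (rule AE_commute) measurable
  \<comment> \<open>The radii above \<open>L2_set y J\<close> have positive measure, so a condition
    on \<open>y\<close> alone that holds for almost all of them holds outright. This removes the
    truncation to a ball.\<close>
  also have "\<dots> \<longleftrightarrow> (AE y in ?L. 0 < L2_set y J \<longrightarrow> P y)"
  proof (rule AE_cong)
    fix y
    have "\<not> (AE \<rho> in lborel. \<not> L2_set y J \<le> \<rho>)"
    proof
      assume "AE \<rho> in lborel. \<not> L2_set y J \<le> \<rho>"
      then have "{L2_set y J..} \<in> null_sets lborel"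
        by (subst AE_iff_null_sets) auto
      then have "emeasure lborel {L2_set y J..L2_set y J + 1} = 0"
        using null_sets_subset[of "{L2_set y J..}" lborel "{L2_set y J..L2_set y J + 1}"] by auto
      then show False by simp
    qed
    then show "(AE \<rho> in lborel. 0 < \<rho> \<and> 0 < L2_set y J \<and> L2_set y J \<le> \<rho> \<longrightarrow> P y) \<longleftrightarrow> (0 < L2_set y J \<longrightarrow> P y)"
    proof (cases "0 < L2_set y J \<and> \<not> P y")
      case True
      have "\<not> (AE \<rho> in lborel. 0 < \<rho> \<and> 0 < L2_set y J \<and> L2_set y J \<le> \<rho> \<longrightarrow> P y)"
      proof
        assume "AE \<rho> in lborel. 0 < \<rho> \<and> 0 < L2_set y J \<and> L2_set y J \<le> \<rho> \<longrightarrow> P y"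
        then have "AE \<rho> in lborel. \<not> L2_set y J \<le> \<rho>"
          by (rule eventually_mono) (use True in auto)
        with \<open>\<not> (AE \<rho> in lborel. \<not> L2_set y J \<le> \<rho>)\<close> show False by simp
      qed
      with True show ?thesis by simp
    qed auto
  qed
  also have "\<dots> \<longleftrightarrow> (AE y in ?L. P y)"
  proof -
    obtain j where j: "j \<in> J" using J by auto
    have "AE y in ?L. 0 < L2_set y J"
      using AE_PiM_lborel_nonzero[OF J(1) j]
    proof eventually_elim
      case (elim y)
      then have "L2_set y J \<noteq> 0" using J j by (auto simp: L2_set_eq_0_iff)
      then show ?case by (simp add: less_le)
    qed
    then show ?thesis by (auto elim: eventually_elim2)
  qed
  finally show ?thesis .
qed

text \<open>Moves the radius into the vector, so that a condition in polar coordinates becomes a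
  condition on the Cartesian point.\<close>

lemma set_block_eq_set_block_1: "set_block J x \<rho> \<omega> = set_block J x 1 (\<lambda>j\<in>J. \<rho> * \<omega> j)"
  by (simp add: set_block_def vec_eq_iff)

text \<open>When all coordinates are replaced, \<open>x\<close> no longer matters and
  \<open>set_block UNIV x 1\<close> is the canonical passage from functions to vectors. Lebesgue
  measure is determined by its values on boxes.\<close>

lemma lborel_vec_eq_distr_PiM:
  "(lborel :: (real ^ 'n::finite) measure) = distr (Pi\<^sub>M UNIV (\<lambda>_. lborel)) borel (\<lambda>y. set_block UNIV x 1 y)"
proof (rule lborel_eqI)
  fix l u :: "real ^ 'n"
  assume le: "\<And>e. e \<in> Basis \<Longrightarrow> l \<bullet> e \<le> u \<bullet> e"
  have "emeasure (distr (Pi\<^sub>M UNIV (\<lambda>_. lborel)) borel (\<lambda>y. set_block UNIV x 1 y)) (box l u)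
     = emeasure (Pi\<^sub>M UNIV (\<lambda>_. lborel)) ((\<lambda>y. set_block UNIV x 1 y) -` box l u \<inter> space (Pi\<^sub>M UNIV (\<lambda>_. lborel)))"
    by (rule emeasure_distr) auto
  also have "(\<lambda>y. set_block UNIV x 1 y) -` box l u \<inter> space (Pi\<^sub>M UNIV (\<lambda>_. lborel)) = Pi\<^sub>E UNIV (\<lambda>j. {l $ j <..< u $ j})"
    by (auto simp: space_PiM set_block_def mem_box_cart PiE_def Pi_def)
  also have "emeasure (Pi\<^sub>M UNIV (\<lambda>_. lborel)) \<dots> = (\<Prod>j\<in>UNIV. emeasure lborel {l $ j <..< u $ j})"
    by (intro PiL.emeasure_PiM) auto
  also have "\<dots> = (\<Prod>j\<in>UNIV. ennreal (u $ j - l $ j))"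
  proof (intro prod.cong refl)
    fix j
    have "l $ j \<le> u $ j"
      using le[of "axis j 1"] by (simp add: inner_axis)
    then show "emeasure lborel {l $ j <..< u $ j} = ennreal (u $ j - l $ j)" by simp
  qed
  also have "\<dots> = (\<Prod>e\<in>Basis. ennreal ((u - l) \<bullet> e))"
  proof -
    have "bij_betw (\<lambda>j. axis j 1) UNIV (Basis :: (real ^ 'n) set)"
      by (auto simp: bij_betw_def inj_on_def Basis_vec_def axis_eq_axis image_iff)
    from prod.reindex_bij_betw[OF this, of "\<lambda>e. ennreal ((u - l) \<bullet> e)"]
    show ?thesis by (simp add: inner_axis)
  qed
  also have "\<dots> = ennreal (\<Prod>e\<in>Basis. (u - l) \<bullet> e)"
    using le by (intro prod_ennreal) (auto simp: inner_diff_left)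
  finally show "emeasure (distr (Pi\<^sub>M UNIV (\<lambda>_. lborel)) borel (\<lambda>y. set_block UNIV x 1 y)) (box l u)
     = ennreal (\<Prod>e\<in>Basis. (u - l) \<bullet> e)" .
qed simp

context dunkl_blocks
begin

lemma block_norm_eq_0_iff_AE:
  assumes J: "J \<noteq> {}" and F[measurable]: "F \<in> borel_measurable borel" and q: "0 < q'"
  shows "block_norm k J p' q' F x = 0 \<longleftrightarrow>
    (AE \<rho> in lborel. 0 < \<rho> \<longrightarrow> (AE \<omega> in dunkl_sphere_measure k J. F (set_block J x \<rho> \<omega>) = 0))"
proof -
  have F': "(\<lambda>(z::unit, x). F x) \<in> borel_measurable (count_space UNIV \<Otimes>\<^sub>M borel)"
    using F by simp
  have [measurable]: "(\<lambda>\<rho>. Lp_norm (dunkl_sphere_measure k J) q' (\<lambda>\<omega>. F (set_block J x \<rho> \<omega>))) \<in> borel_measurable borel"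
    using measurable_Pair2[OF measurable_inner_norm[OF J F', of q'], of "((), x)"] by (simp add: space_pair_measure)
  have [measurable]: "(\<lambda>\<omega>. F (set_block J x \<rho> \<omega>)) \<in> borel_measurable (dunkl_sphere_measure k J)" for \<rho>
    by measurable
  show ?thesis
    unfolding block_norm_eq[OF J F q]
    by (subst Lp_norm_eq_0_iff) (simp_all add: AE_radial_measure_iff Lp_norm_eq_0_iff)
qed

lemma block_norm_eq_0_iff:
  assumes J: "J \<noteq> {}" and F[measurable]: "F \<in> borel_measurable borel" and q: "0 < q'"
  shows "block_norm k J p' q' F x = 0 \<longleftrightarrow> (AE y in Pi\<^sub>M J (\<lambda>_. lborel). F (set_block J x 1 y) = 0)"
proof -
  have "(AE \<omega> in dunkl_sphere_measure k J. F (set_block J x \<rho> \<omega>) = 0) \<longleftrightarrow>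
      (AE \<omega> in sphere_measure J. F (set_block J x 1 (\<lambda>j\<in>J. \<rho> * \<omega> j)) = 0)" for \<rho>
    using J by (simp add: AE_dunkl_sphere_measure_iff set_block_eq_set_block_1[of J x \<rho>])
  moreover have "{y \<in> space (Pi\<^sub>M J (\<lambda>_. lborel)). F (set_block J x 1 y) = 0} \<in> sets (Pi\<^sub>M J (\<lambda>_. lborel))"
    by measurable
  ultimately show ?thesis
    using AE_polar_iff[OF finite J, of "\<lambda>y. F (set_block J x 1 y) = 0"]
    by (simp only: block_norm_eq_0_iff_AE[OF assms])
qed

text \<open>Each induction step adds one block to the coordinates over which the condition is
  required almost everywhere: polar coordinates give the condition on the new block, and Fubini for
  null sets merges it with the earlier ones.\<close>

lemma iterated_norm_eq_0_iff:
  assumes "i \<le> m" and F[measurable]: "F \<in> borel_measurable borel"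
  shows "iterated_norm b k p q i F x = 0 \<longleftrightarrow>
    (AE y in Pi\<^sub>M {j. b j \<in> {1..i}} (\<lambda>_. lborel). F (set_block {j. b j \<in> {1..i}} x 1 y) = 0)"
  using assms(1)
proof (induction i arbitrary: x)
  case 0
  have eq: "{j. b j \<in> {1..0}} = {}" by auto
  show ?case
    unfolding eq PiM_empty AE_count_space by (simp add: set_block_def)
next
  case (Suc i)
  let ?J = "block b (Suc i)" and ?B = "{j. b j \<in> {1..i}}"
  have B: "{j. b j \<in> {1..Suc i}} = ?J \<union> ?B" and disj: "?J \<inter> ?B = {}"
    by (auto simp: block_def)
  interpret L1: sigma_finite_measure "Pi\<^sub>M ?J (\<lambda>_. lborel :: real measure)" by (rule PiL.sigma_finite) simp
  interpret L2: sigma_finite_measure "Pi\<^sub>M ?B (\<lambda>_. lborel :: real measure)" by (rule PiL.sigma_finite) simp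
  interpret pair_sigma_finite "Pi\<^sub>M ?J (\<lambda>_. lborel :: real measure)" "Pi\<^sub>M ?B (\<lambda>_. lborel :: real measure)" ..
  \<comment> \<open>The blocks are disjoint, so replacing the coordinates of one and then of the
    others is a single replacement on the union.\<close>
  have merge: "set_block ?B (set_block ?J x 1 y) 1 z = set_block (?J \<union> ?B) x 1 (merge ?J ?B (y, z))" for y z
    by (auto simp: set_block_def merge_def vec_eq_iff block_def)
  have "iterated_norm b k p q (Suc i) F x = 0 \<longleftrightarrow>
     (AE y in Pi\<^sub>M ?J (\<lambda>_. lborel). iterated_norm b k p q i F (set_block ?J x 1 y) = 0)"
    using Suc.prems pq_pos[of i] by (simp add: block_norm_eq_0_iff measurable_iterated_norm)
  also have "\<dots> \<longleftrightarrow> (AE y in Pi\<^sub>M ?J (\<lambda>_. lborel). AE z in Pi\<^sub>M ?B (\<lambda>_. lborel).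
      F (set_block ?B (set_block ?J x 1 y) 1 z) = 0)"
    using Suc by simp
  also have "\<dots> \<longleftrightarrow> (AE y in Pi\<^sub>M ?J (\<lambda>_. lborel). AE z in Pi\<^sub>M ?B (\<lambda>_. lborel).
      F (set_block (?J \<union> ?B) x 1 (merge ?J ?B (y, z))) = 0)"
    by (simp only: merge)
  also have "\<dots> \<longleftrightarrow> (AE w in Pi\<^sub>M ?J (\<lambda>_. lborel) \<Otimes>\<^sub>M Pi\<^sub>M ?B (\<lambda>_. lborel).
      F (set_block (?J \<union> ?B) x 1 (merge ?J ?B (fst w, snd w))) = 0)"
    by (rule AE_pair_iff) measurable
  also have "\<dots> \<longleftrightarrow> (AE w in distr (Pi\<^sub>M ?J (\<lambda>_. lborel) \<Otimes>\<^sub>M Pi\<^sub>M ?B (\<lambda>_. lborel)) (Pi\<^sub>M (?J \<union> ?B) (\<lambda>_. lborel)) (merge ?J ?B).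
      F (set_block (?J \<union> ?B) x 1 w) = 0)"
    by (subst AE_distr_iff) auto
  also have "distr (Pi\<^sub>M ?J (\<lambda>_. lborel) \<Otimes>\<^sub>M Pi\<^sub>M ?B (\<lambda>_. lborel)) (Pi\<^sub>M (?J \<union> ?B) (\<lambda>_. lborel :: real measure)) (merge ?J ?B)
      = Pi\<^sub>M (?J \<union> ?B) (\<lambda>_. lborel)"
    using disj by (intro PiL.distr_merge) auto
  finally show ?case unfolding B .
qed

lemma iterated_norm_full_eq_0_iff:
  assumes F[measurable]: "F \<in> borel_measurable borel"
  shows "iterated_norm b k p q m F x = 0 \<longleftrightarrow> (AE y in lborel. F y = 0)"
proof -
  have "{j. b j \<in> {1..m}} = UNIV"
    unfolding range_b[symmetric] by auto
  moreover have "(AE y in lborel. F y = 0) \<longleftrightarrow> (AE y in Pi\<^sub>M UNIV (\<lambda>_. lborel). F (set_block UNIV x 1 y) = 0)"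
    by (subst lborel_vec_eq_distr_PiM[of x], subst AE_distr_iff) auto
  ultimately show ?thesis
    using iterated_norm_eq_0_iff[OF order_refl F, of x] by (simp only:)
qed

text \<open>
  No measurability is assumed: the sections of a Lebesgue measurable function need not be measurable.
\<close>

lemma iterated_norm_cong_AE:
  assumes "AE y in lborel. F y = G y"
  shows "iterated_norm b k p q m F x = iterated_norm b k p q m G x"
proof -
  \<comment> \<open>A Borel null set is needed, so that the criterion for a vanishing norm can be
    applied to its indicator, even though \<open>F\<close> and \<open>G\<close> may fail to be
    measurable.\<close>
  obtain N where N: "N \<in> null_sets lborel" "{y. F y \<noteq> G y} \<subseteq> N"
    using assms by (auto simp: eventually_ae_filter)
  then have [measurable]: "N \<in> sets borel" by auto
  have meas: "(indicator N :: _ \<Rightarrow> ennreal) \<in> borel_measurable borel" by measurable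
  \<comment> \<open>The induction runs over points where the norm of the indicator vanishes.
    Vanishing at level \<open>Suc i\<close> means vanishing at level \<open>i\<close> for almost all
    radii and directions, and at those points the two inner norms agree by induction.\<close>
  have "iterated_norm b k p q i F x = iterated_norm b k p q i G x"
    if "i \<le> m" "iterated_norm b k p q i (indicator N) x = 0" for i x
    using that
  proof (induction i arbitrary: x)
    case 0
    then show ?case using N(2) by (auto simp: indicator_def split: if_splits)
  next
    case (Suc i)
    then have "AE \<rho> in lborel. 0 < \<rho> \<longrightarrow> (AE \<omega> in dunkl_sphere_measure k (block b (Suc i)).
        iterated_norm b k p q i (indicator N) (set_block (block b (Suc i)) x \<rho> \<omega>) = 0)"
      using pq_pos[of i] meas by (simp add: block_norm_eq_0_iff_AE measurable_iterated_norm)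
    then have "AE \<rho> in lborel. 0 < \<rho> \<longrightarrow> (AE \<omega> in dunkl_sphere_measure k (block b (Suc i)).
        iterated_norm b k p q i F (set_block (block b (Suc i)) x \<rho> \<omega>) =
        iterated_norm b k p q i G (set_block (block b (Suc i)) x \<rho> \<omega>))"
    proof (rule eventually_mono)
      fix \<rho>
      assume *: "0 < \<rho> \<longrightarrow> (AE \<omega> in dunkl_sphere_measure k (block b (Suc i)).
        iterated_norm b k p q i (indicator N) (set_block (block b (Suc i)) x \<rho> \<omega>) = 0)"
      have "iterated_norm b k p q i (indicator N) y = 0 \<Longrightarrow> iterated_norm b k p q i F y = iterated_norm b k p q i G y" for y
        using Suc by simp
      with * show "0 < \<rho> \<longrightarrow> (AE \<omega> in dunkl_sphere_measure k (block b (Suc i)).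
        iterated_norm b k p q i F (set_block (block b (Suc i)) x \<rho> \<omega>) =
        iterated_norm b k p q i G (set_block (block b (Suc i)) x \<rho> \<omega>))"
        by (auto elim!: eventually_mono)
    qed
    then show ?case by (simp add: block_norm_cong_AE)
  qed
  moreover have "iterated_norm b k p q m (indicator N) x = 0"
    unfolding iterated_norm_full_eq_0_iff[OF meas]
    using N(1) by (auto simp: AE_iff_null_sets[symmetric] indicator_eq_0_iff dest: AE_not_in)
  ultimately show ?thesis by blast
qed

text \<open>The function \<open>F\<close> dominates \<open>top\<close> times the indicator of the
  set where it is infinite. By homogeneity a finite norm forces the norm of this indicator to be
  \<open>0\<close>.\<close>

lemma iterated_norm_finite_imp_AE_finite:
  assumes F[measurable]: "F \<in> borel_measurable borel" and fin: "iterated_norm b k p q m F x < top"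
  shows "AE y in lborel. F y < top"
proof -
  let ?N = "{y. F y = top}"
  have [measurable]: "?N \<in> sets borel"
    using measurable_sets[OF F, of "{top}"] by (simp add: vimage_def)
  have meas: "(indicator ?N :: _ \<Rightarrow> ennreal) \<in> borel_measurable borel" by measurable
  have "top * iterated_norm b k p q m (indicator ?N) x = iterated_norm b k p q m (\<lambda>y. top * indicator ?N y) x"
    by (rule iterated_norm_cmult[symmetric, OF order_refl meas])
  also have "\<dots> \<le> iterated_norm b k p q m F x"
    by (intro iterated_norm_mono) (auto simp: indicator_def)
  finally have "top * iterated_norm b k p q m (indicator ?N) x \<noteq> top"
    using fin by auto
  then have "iterated_norm b k p q m (indicator ?N) x = 0"
    by (auto simp: ennreal_top_mult split: if_splits)
  then show ?thesis
    unfolding iterated_norm_full_eq_0_iff[OF meas]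
    by (auto elim!: eventually_mono simp: indicator_eq_0_iff less_top)
qed

end

section \<open>Balls and powers of the norm\<close>

lemma nn_integral_powr_finite:
  fixes a c :: real
  assumes "0 < a" "0 \<le> c"
  shows "(\<integral>\<^sup>+s. ennreal (s powr (a - 1)) * indicator {0<..c} s \<partial>lborel) < top"
proof -
  have "(\<lambda>s. s powr (a - 1)) integrable_on {0<..c}"
    using assms by (intro integrable_on_powr_from_0') auto
  then obtain I where "((\<lambda>s. s powr (a - 1)) has_integral I) {0<..c}"
    by (auto simp: integrable_on_def)
  then have "(\<integral>\<^sup>+s. ennreal (s powr (a - 1)) * indicator {0<..c} s \<partial>lborel) = ennreal I"
    by (intro nn_integral_has_integral_lebesgue') auto
  then show ?thesis by simp
qed

lemma pred_mem_ball [measurable]: "Measurable.pred borel (\<lambda>x. x \<in> ball (c :: 'a::metric_space) r)"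
  unfolding pred_def using borel_open[OF open_ball[of c r]] by (simp del: mem_ball)

text \<open>The unit ball has positive measure. Used to pick a point from a property that holds
  almost everywhere and, with \<open>P\<close> false, to show that a function does not vanish almost
  everywhere.\<close>

lemma AE_ball_imp_ex:
  assumes "AE x in lborel. x \<in> ball (0 :: 'a::euclidean_space) 1 \<longrightarrow> P x"
  shows "\<exists>x\<in>ball 0 1. P x"
proof (rule ccontr)
  assume "\<not> ?thesis"
  with assms have "AE x in lborel. x \<notin> ball (0 :: 'a) 1"
    by (auto elim!: eventually_mono)
  then have "emeasure lborel (ball (0 :: 'a) 1) = 0"
    by (subst (asm) AE_iff_null_sets[symmetric]) auto
  then show False
    using unit_ball_vol_pos[of "real DIM('a)"] by (simp add: emeasure_ball del: unit_ball_vol_pos)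
qed

lemma AE_lborel_vec_nonzero: "AE x in lborel. \<forall>j. (x :: real ^ 'n::finite) $ j \<noteq> 0"
proof -
  have "AE x in lborel. \<forall>j\<in>UNIV. (x :: real ^ 'n) $ j \<noteq> 0"
  proof (intro AE_finite_allI ballI)
    fix j :: 'n
    have "AE y in Pi\<^sub>M (UNIV :: 'n set) (\<lambda>_. lborel :: real measure). y j \<noteq> 0"
      by (intro AE_PiM_lborel_nonzero) auto
    then show "AE x in lborel. (x :: real ^ 'n) $ j \<noteq> 0"
      by (subst lborel_vec_eq_distr_PiM[of 0], subst AE_distr_iff) (auto simp: set_block_def)
  qed simp
  then show ?thesis by simp
qed

context dunkl_blocks
begin

abbreviation hom_dim :: real where
  "hom_dim \<equiv> dunkl_dim k UNIV"

text \<open>The homogeneity exponent of the mixed norm: the norm of a ball grows like its radius to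
  this power.\<close>

definition norm_dim :: real where
  "norm_dim = (\<Sum>i=1..m. dunkl_dim k (block b i) / p i)"

abbreviation mnorm :: "(real ^ 'n \<Rightarrow> ennreal) \<Rightarrow> ennreal" where
  "mnorm F \<equiv> iterated_norm b k p q m F 0"

lemma dunkl_dim_ge_1: "J \<noteq> {} \<Longrightarrow> 1 \<le> dunkl_dim k J"
proof -
  assume "J \<noteq> {}"
  then have "1 \<le> card J" by (simp add: Suc_le_eq card_gt_0_iff)
  moreover have "0 \<le> (\<Sum>j\<in>J. k j)" by (intro sum_nonneg k_nonneg)
  ultimately show ?thesis by (simp add: dunkl_dim_def)
qed

lemma mnorm_scale:
  assumes "F \<in> borel_measurable borel" "0 < t"
  shows "mnorm (\<lambda>x. F (t *\<^sub>R x)) = ennreal (t powr (- norm_dim)) * mnorm F"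
  using iterated_norm_scale[OF order_refl assms, of 0] by (simp add: norm_dim_def)

lemma mnorm_cmult: "F \<in> borel_measurable borel \<Longrightarrow> mnorm (\<lambda>x. c * F x) = c * mnorm F"
  by (rule iterated_norm_cmult[OF order_refl])

lemma mnorm_mono: "(\<And>x. F x \<le> G x) \<Longrightarrow> mnorm F \<le> mnorm G"
  by (rule iterated_norm_mono[OF order_refl])

section \<open>Mixed norms of balls\<close>

lemma measurable_slab [measurable]: "{x :: real ^ 'n. \<forall>j. j \<notin> B \<longrightarrow> \<bar>x $ j\<bar> < 1} \<in> sets borel"
proof -
  have "{x \<in> space borel. \<forall>j\<in>- B. \<bar>x $ j\<bar> < (1::real)} \<in> sets (borel :: (real ^ 'n) measure)"
    by measurable
  then show ?thesis by (simp add: Ball_def)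
qed

text \<open>Slabs replace balls because they are compatible with the blocks: the constraint on
  coordinates outside \<open>J\<close> passes through the norm, and the one on \<open>J\<close>
  confines the radius. The set \<open>B\<close> collects the coordinates already integrated, on
  which the slab imposes nothing.\<close>

lemma block_norm_slab_finite:
  assumes J: "J \<noteq> {}" and "J \<inter> B = {}" and pq: "0 < p'" "0 < q'"
  shows "\<exists>C<top. \<forall>x. block_norm k J p' q' (indicator {x. \<forall>j. j \<notin> B \<longrightarrow> \<bar>x $ j\<bar> < 1}) x
    \<le> C * indicator {x. \<forall>j. j \<notin> J \<union> B \<longrightarrow> \<bar>x $ j\<bar> < 1} x"
proof -
  let ?A = "{x :: real ^ 'n. \<forall>j. j \<notin> B \<longrightarrow> \<bar>x $ j\<bar> < 1}"
  let ?A' = "{x :: real ^ 'n. \<forall>j. j \<notin> J \<union> B \<longrightarrow> \<bar>x $ j\<bar> < 1}"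
  let ?S = "dunkl_sphere_measure k J" and ?c = "real (card J)"
  let ?K = "enn_powr (emeasure ?S (space ?S)) (1 / q')"
  let ?I = "enn_powr (\<integral>\<^sup>+\<rho>. ennreal (\<rho> powr (dunkl_dim k J - 1)) * indicator {0<..?c} \<rho> \<partial>lborel) (1 / p')"
  interpret S: finite_measure ?S
    using J by (intro finite_measure_dunkl_sphere_measure k_nonneg) auto
  have "?K < top"
    using S.emeasure_finite[of "space ?S"] by (simp add: less_top[symmetric])
  moreover have "?I < top"
    using nn_integral_powr_finite[of "dunkl_dim k J" ?c] dunkl_dim_ge_1[OF J] by (simp add: less_top[symmetric])
  ultimately have "?K * ?I < top"
    by (simp add: ennreal_mult_less_top)
  moreover have "block_norm k J p' q' (indicator ?A) x \<le> ?K * ?I * indicator ?A' x" for x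
  proof -
    have meas: "(indicator ?A :: _ \<Rightarrow> ennreal) \<in> borel_measurable borel"
      by measurable
    have eq: "block_norm k J p' q' (indicator ?A) x = Lp_norm (radial_measure k J) p'
        (\<lambda>\<rho>. Lp_norm ?S q' (\<lambda>\<omega>. indicator ?A (set_block J x \<rho> \<omega>)))"
      using pq by (intro block_norm_eq[OF J meas])
    have le: "Lp_norm ?S q' (\<lambda>\<omega>. indicator ?A (set_block J x \<rho> \<omega>)) \<le> (?K * indicator ?A' x) * indicator {..?c} \<rho>"
      if "0 < \<rho>" for \<rho>
    proof -
      have "AE \<omega> in ?S. (indicator ?A (set_block J x \<rho> \<omega>) :: ennreal) \<le> indicator ?A' x * indicator {..?c} \<rho>"
      proof -
        have "AE \<omega> in ?S. L2_set \<omega> J = 1"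
          using J by (simp add: AE_dunkl_sphere_measure_iff AE_sphere_measure_L2_set)
        then show ?thesis
        proof eventually_elim
          case (elim \<omega>)
          have "x \<in> ?A' \<and> \<rho> \<le> ?c" if in_A: "set_block J x \<rho> \<omega> \<in> ?A"
          proof
            show "x \<in> ?A'"
            proof (intro CollectI allI impI)
              fix j assume "j \<notin> J \<union> B"
              then show "\<bar>x $ j\<bar> < 1"
                using in_A by (auto simp: set_block_def dest!: spec[of _ j])
            qed
            \<comment> \<open>On the unit sphere the radius equals the Euclidean norm of the scaled
              direction, hence is at most the sum of the moduli of its \<open>card J\<close>
              coordinates, each below \<open>1\<close>. This explains \<open>?c\<close>.\<close>
            have "\<bar>\<rho> * \<omega> j\<bar> < 1" if "j \<in> J" for j
              using in_A that assms(2) by (auto simp: set_block_def dest!: spec[of _ j])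
            then have "(\<Sum>j\<in>J. \<bar>\<rho> * \<omega> j\<bar>) \<le> (\<Sum>j\<in>J. 1)"
              by (intro sum_mono) (auto intro: less_imp_le)
            moreover have "\<rho> = L2_set (\<lambda>j. \<rho> * \<omega> j) J"
              using elim \<open>0 < \<rho>\<close> by (simp add: L2_set_right_distrib[symmetric])
            moreover have "L2_set (\<lambda>j. \<rho> * \<omega> j) J \<le> (\<Sum>j\<in>J. \<bar>\<rho> * \<omega> j\<bar>)"
              by (rule L2_set_le_sum_abs)
            ultimately show "\<rho> \<le> ?c" by simp
          qed
          then show ?case by (auto simp: indicator_def)
        qed
      qed
      then have "Lp_norm ?S q' (\<lambda>\<omega>. indicator ?A (set_block J x \<rho> \<omega>))
          \<le> Lp_norm ?S q' (\<lambda>\<omega>. indicator ?A' x * indicator {..?c} \<rho>)"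
        using pq by (intro Lp_norm_mono_AE) auto
      also have "\<dots> = (?K * indicator ?A' x) * indicator {..?c} \<rho>"
        using pq by (simp add: Lp_norm_const mult_ac)
      finally show ?thesis .
    qed
    have "block_norm k J p' q' (indicator ?A) x \<le>
        Lp_norm (radial_measure k J) p' (\<lambda>\<rho>. (?K * indicator ?A' x) * indicator {..?c} \<rho>)"
      unfolding eq using le pq by (intro Lp_norm_mono_AE) (auto simp: AE_radial_measure_iff)
    also have "\<dots> = (?K * indicator ?A' x) * Lp_norm (radial_measure k J) p' (indicator {..?c})"
      using pq by (intro Lp_norm_cmult) auto
    also have "Lp_norm (radial_measure k J) p' (indicator {..?c}) = ?I"
    proof -
      have "(\<integral>\<^sup>+\<rho>. enn_powr (indicator {..?c} \<rho>) p' \<partial>radial_measure k J)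
          = (\<integral>\<^sup>+\<rho>. ennreal (indicator {0<..} \<rho> * \<rho> powr (dunkl_dim k J - 1)) * enn_powr (indicator {..?c} \<rho>) p' \<partial>lborel)"
        unfolding radial_measure_def by (rule nn_integral_density) measurable
      also have "\<dots> = (\<integral>\<^sup>+\<rho>. ennreal (\<rho> powr (dunkl_dim k J - 1)) * indicator {0<..?c} \<rho> \<partial>lborel)"
        by (intro nn_integral_cong) (auto simp: indicator_def)
      finally show ?thesis by (simp add: Lp_norm_def)
    qed
    finally show ?thesis by (simp add: mult_ac)
  qed
  ultimately show ?thesis by blast
qed

text \<open>The unit ball lies in the unit cube, the slab without free coordinates. Every block
  frees its own coordinates at the cost of a finite factor, and after all blocks only a constant is
  left.\<close>

lemma iterated_norm_ball_finite:
  assumes "i \<le> m"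
  shows "\<exists>C<top. \<forall>x. iterated_norm b k p q i (indicator (ball 0 1)) x
    \<le> C * indicator {x. \<forall>j. j \<notin> {j. b j \<in> {1..i}} \<longrightarrow> \<bar>x $ j\<bar> < 1} x"
  using assms
proof (induction i)
  case 0
  have "indicator (ball 0 1) x \<le> 1 * (indicator {x. \<forall>j. j \<notin> {j. b j \<in> {1..0}} \<longrightarrow> \<bar>x $ j\<bar> < 1} x :: ennreal)" for x :: "real ^ 'n"
    using component_le_norm_cart[of x] by (auto simp: indicator_def intro: le_less_trans)
  then show ?case by (intro exI[of _ 1]) simp
next
  case (Suc i)
  let ?J = "block b (Suc i)" and ?B = "{j. b j \<in> {1..i}}"
  let ?A = "\<lambda>B. {x :: real ^ 'n. \<forall>j. j \<notin> B \<longrightarrow> \<bar>x $ j\<bar> < 1}"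
  have B: "{j. b j \<in> {1..Suc i}} = ?J \<union> ?B" and disj: "?J \<inter> ?B = {}"
    by (auto simp: block_def)
  obtain C where C: "C < top" "\<And>x. iterated_norm b k p q i (indicator (ball 0 1)) x \<le> C * indicator (?A ?B) x"
    using Suc by auto
  obtain D where D: "D < top" "\<And>x. block_norm k ?J (p (Suc i)) (q (Suc i)) (indicator (?A ?B)) x \<le> D * indicator (?A (?J \<union> ?B)) x"
    using block_norm_slab_finite[of ?J ?B "p (Suc i)" "q (Suc i)"] pq_pos[of i] Suc.prems disj by auto
  have meas: "(indicator (?A ?B) :: _ \<Rightarrow> ennreal) \<in> borel_measurable borel"
    by measurable
  have "iterated_norm b k p q (Suc i) (indicator (ball 0 1)) x \<le> (C * D) * indicator (?A (?J \<union> ?B)) x" for x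
  proof -
    have "iterated_norm b k p q (Suc i) (indicator (ball 0 1)) x
        \<le> block_norm k ?J (p (Suc i)) (q (Suc i)) (\<lambda>x. C * indicator (?A ?B) x) x"
      using pq_pos[of i] Suc.prems C by (auto intro!: block_norm_mono)
    also have "\<dots> = C * block_norm k ?J (p (Suc i)) (q (Suc i)) (indicator (?A ?B)) x"
      using pq_pos[of i] Suc.prems meas by (intro block_norm_cmult) auto
    also have "\<dots> \<le> C * (D * indicator (?A (?J \<union> ?B)) x)"
      by (intro mult_left_mono D) simp
    finally show ?thesis by (simp add: mult.assoc)
  qed
  moreover have "C * D < top"
    using C D by (simp add: ennreal_mult_less_top)
  ultimately show ?case unfolding B by blast
qed

lemma mnorm_unit_ball: "0 < mnorm (indicator (ball 0 1))" "mnorm (indicator (ball 0 1)) < top"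
proof -
  have meas: "(indicator (ball 0 1) :: real ^ 'n \<Rightarrow> ennreal) \<in> borel_measurable borel"
    by measurable
  obtain C where C: "C < top" "\<And>x. iterated_norm b k p q m (indicator (ball 0 1)) x
    \<le> C * indicator {x. \<forall>j. j \<notin> {j. b j \<in> {1..m}} \<longrightarrow> \<bar>x $ j\<bar> < 1} x"
    using iterated_norm_ball_finite[OF order_refl] by auto
  have "C * indicator A x \<le> C" for A and x :: "real ^ 'n"
    by (auto simp: indicator_def)
  with C show "mnorm (indicator (ball 0 1)) < top"
    by (meson le_less_trans)
  have "\<not> (AE x in lborel. indicator (ball 0 1) (x :: real ^ 'n) = (0::ennreal))"
  proof
    assume "AE x in lborel. indicator (ball 0 1) (x :: real ^ 'n) = (0::ennreal)"
    then have "AE x in lborel. (x :: real ^ 'n) \<in> ball 0 1 \<longrightarrow> False"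
      by (auto elim!: eventually_mono simp: indicator_def)
    then show False using AE_ball_imp_ex[of "\<lambda>_ :: real ^ 'n. False"] by simp
  qed
  then show "0 < mnorm (indicator (ball 0 1))"
    unfolding zero_less_iff_neq_zero iterated_norm_full_eq_0_iff[OF meas] .
qed

lemma ball_indicator_scale:
  assumes "0 < t"
  shows "(indicator (ball 0 (t * r)) (t *\<^sub>R x) :: 'a::zero_neq_one) = indicator (ball (0 :: real ^ 'n) r) x"
  using assms by (auto simp: indicator_def)

lemma mnorm_ball:
  assumes "0 < R"
  shows "mnorm (indicator (ball 0 R)) = ennreal (R powr norm_dim) * mnorm (indicator (ball 0 1))"
proof -
  have "mnorm (indicator (ball 0 1)) = mnorm (\<lambda>x. indicator (ball 0 R) (R *\<^sub>R x))"
    using ball_indicator_scale[OF assms, of 1, where ?'a = ennreal] by simp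
  also have "\<dots> = ennreal (R powr (- norm_dim)) * mnorm (indicator (ball 0 R))"
    using assms by (intro mnorm_scale) measurable
  finally have "ennreal (R powr norm_dim) * mnorm (indicator (ball 0 1))
      = (ennreal (R powr norm_dim) * ennreal (R powr (- norm_dim))) * mnorm (indicator (ball 0 R))"
    by (simp add: mult.assoc)
  also have "ennreal (R powr norm_dim) * ennreal (R powr (- norm_dim)) = 1"
    using assms by (simp add: ennreal_mult[symmetric] powr_add[symmetric])
  finally show ?thesis by simp
qed

section \<open>Dunkl volume of balls\<close>

lemma dunkl_weight_scale:
  assumes "0 < R"
  shows "dunkl_weight k J (\<lambda>j. R * y j) = R powr (2 * (\<Sum>j\<in>J. k j)) * dunkl_weight k J y"
proof -
  have "dunkl_weight k J (\<lambda>j. R * y j) = (\<Prod>j\<in>J. R powr (2 * k j) * (if k j = 0 then 1 else \<bar>y j\<bar> powr (2 * k j)))"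
    unfolding dunkl_weight_def using assms by (intro prod.cong) (auto simp: abs_mult powr_mult)
  also have "\<dots> = R powr (2 * (\<Sum>j\<in>J. k j)) * dunkl_weight k J y"
    using assms by (simp add: prod.distrib dunkl_weight_def powr_sum sum_distrib_left)
  finally show ?thesis .
qed

lemma emeasure_dunkl_measure:
  assumes [measurable]: "A \<in> sets borel"
  shows "emeasure (dunkl_measure k) A
    = (\<integral>\<^sup>+x. ennreal (dunkl_weight k UNIV (\<lambda>j. x $ j)) * indicator A x \<partial>lborel)"
proof -
  have "(\<lambda>x. ennreal (dunkl_weight k UNIV (\<lambda>j. x $ j))) \<in> borel_measurable lebesgue"
    by (intro measurable_completion) measurable
  then show ?thesis
    unfolding dunkl_measure_def by (subst emeasure_density) (auto simp: nn_integral_completion)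
qed

definition ball_vol :: real where
  "ball_vol = measure (dunkl_measure k) (ball 0 1)"

text \<open>Finite because the weight is at most \<open>1\<close> on the unit ball, positive because
  it vanishes at most on the coordinate hyperplanes.\<close>

lemma ball_vol_pos: "0 < ball_vol"
  and emeasure_dunkl_unit_ball: "emeasure (dunkl_measure k) (ball 0 1) = ennreal ball_vol"
proof -
  have eq: "emeasure (dunkl_measure k) (ball 0 1)
    = (\<integral>\<^sup>+x. ennreal (dunkl_weight k UNIV (\<lambda>j. x $ j)) * indicator (ball 0 1) x \<partial>lborel)"
    by (rule emeasure_dunkl_measure) simp
  also have "\<dots> \<le> (\<integral>\<^sup>+x. indicator (ball 0 1) (x :: real ^ 'n) \<partial>lborel)"
  proof (intro nn_integral_mono)
    fix x :: "real ^ 'n"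
    show "ennreal (dunkl_weight k UNIV (\<lambda>j. x $ j)) * indicator (ball 0 1) x \<le> indicator (ball 0 1) x"
    proof -
      have "\<bar>x $ j\<bar> \<le> 1" if "norm x < 1" for j
        using component_le_norm_cart[of x j] that by simp
      then show ?thesis
        by (auto simp: indicator_def intro!: dunkl_weight_le_1 k_nonneg)
    qed
  qed
  also have "\<dots> < top"
    using emeasure_lborel_ball_finite[of "0 :: real ^ 'n" 1] by simp
  finally have fin: "emeasure (dunkl_measure k) (ball 0 1) < top" .
  then show em: "emeasure (dunkl_measure k) (ball 0 1) = ennreal ball_vol"
    unfolding ball_vol_def by (intro emeasure_eq_ennreal_measure) auto
  have "emeasure (dunkl_measure k) (ball 0 1) \<noteq> 0"
  proof
    assume "emeasure (dunkl_measure k) (ball 0 1) = 0"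
    then have "AE x in lborel. ennreal (dunkl_weight k UNIV (\<lambda>j. x $ j)) * indicator (ball 0 1) x = 0"
      unfolding eq by (subst (asm) nn_integral_0_iff_AE) auto
    then have "AE x in lborel. x \<in> ball (0 :: real ^ 'n) 1 \<longrightarrow> False"
      using AE_lborel_vec_nonzero
    proof eventually_elim
      case (elim x)
      then have "0 < dunkl_weight k UNIV (\<lambda>j. x $ j)"
        by (intro dunkl_weight_pos) auto
      with elim show ?case by (auto simp: indicator_def)
    qed
    then show False using AE_ball_imp_ex[of "\<lambda>_ :: real ^ 'n. False"] by simp
  qed
  then show "0 < ball_vol"
    using em by (cases "ball_vol > 0") (auto simp: ennreal_neg)
qed

text \<open>A dilation by \<open>R\<close> contributes \<open>R ^ CARD('n)\<close> from Lebesgue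
  measure and twice the sum of \<open>k\<close> as an exponent from the weight; together this is
  \<open>hom_dim\<close>.\<close>

lemma measure_dunkl_ball:
  assumes "0 < R"
  shows "measure (dunkl_measure k) (ball 0 R) = ball_vol * R powr hom_dim"
proof -
  let ?w = "\<lambda>x :: real ^ 'n. ennreal (dunkl_weight k UNIV (\<lambda>j. x $ j))"
  let ?h = "\<lambda>x. ?w x * indicator (ball 0 R) x"
  have "emeasure (dunkl_measure k) (ball 0 R) = (\<integral>\<^sup>+x. ?h x \<partial>lborel)"
    by (rule emeasure_dunkl_measure) simp
  also have "\<dots> = (\<integral>\<^sup>+x. ennreal (R ^ CARD('n)) * ?h (R *\<^sub>R x) \<partial>lborel)"
  proof -
    have "(\<integral>\<^sup>+x. ?h x \<partial>lborel) = (\<integral>\<^sup>+x. ?h x \<partial>density (distr lborel borel (\<lambda>x. 0 + R *\<^sub>R x)) (\<lambda>_. \<bar>R\<bar> ^ DIM(real ^ 'n)))"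
      using assms by (subst lborel_affine[of R 0]) simp_all
    also have "\<dots> = (\<integral>\<^sup>+x. ennreal (\<bar>R\<bar> ^ DIM(real ^ 'n)) * ?h x \<partial>distr lborel borel (\<lambda>x. 0 + R *\<^sub>R x))"
      by (rule nn_integral_density) measurable
    also have "\<dots> = (\<integral>\<^sup>+x. ennreal (\<bar>R\<bar> ^ DIM(real ^ 'n)) * ?h (0 + R *\<^sub>R x) \<partial>lborel)"
      by (rule nn_integral_distr) measurable
    finally show ?thesis using assms by simp
  qed
  also have "\<dots> = (\<integral>\<^sup>+x. ennreal (R powr hom_dim) * (?w x * indicator (ball 0 1) x) \<partial>lborel)"
  proof (intro nn_integral_cong)
    fix x :: "real ^ 'n"
    have "dunkl_weight k UNIV (\<lambda>j. (R *\<^sub>R x) $ j) = R powr (2 * (\<Sum>j\<in>UNIV. k j)) * dunkl_weight k UNIV (\<lambda>j. x $ j)"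
      using dunkl_weight_scale[OF assms, of UNIV "\<lambda>j. x $ j"] by simp
    moreover have "R ^ CARD('n) * R powr (2 * (\<Sum>j\<in>UNIV. k j)) = R powr hom_dim"
      using assms by (simp add: dunkl_dim_def powr_add powr_realpow)
    moreover have "(indicator (ball 0 R) (R *\<^sub>R x) :: ennreal) = indicator (ball 0 1) x"
      using ball_indicator_scale[OF assms, of 1] by simp
    ultimately show "ennreal (R ^ CARD('n)) * ?h (R *\<^sub>R x) = ennreal (R powr hom_dim) * (?w x * indicator (ball 0 1) x)"
      using assms dunkl_weight_nonneg[of k UNIV "\<lambda>j. x $ j"]
      by (simp add: mult.assoc[symmetric] ennreal_mult[symmetric])
  qed
  also have "\<dots> = ennreal (R powr hom_dim) * emeasure (dunkl_measure k) (ball 0 1)"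
    by (subst emeasure_dunkl_measure, simp, rule nn_integral_cmult) measurable
  also have "\<dots> = ennreal (ball_vol * R powr hom_dim)"
    using ball_vol_pos by (simp add: emeasure_dunkl_unit_ball ennreal_mult[symmetric] mult.commute)
  finally show ?thesis
    using ball_vol_pos by (simp add: measure_def)
qed

section \<open>The Morrey norm and its denominator\<close>

definition morrey_denom :: "real \<Rightarrow> real \<Rightarrow> ennreal" where
  "morrey_denom l R = ennreal (measure (dunkl_measure k) (ball 0 R) powr l) * mnorm (indicator (ball 0 R))"

text \<open>The volume contributes \<open>hom_dim * l\<close> and the norm of the ball contributes
  \<open>norm_dim\<close>. The lower bound on the Morrey exponent is exactly the positivity of this
  sum.\<close>

lemma morrey_denom_scale:
  assumes "0 < R"
  shows "morrey_denom l R = ennreal (R powr (hom_dim * l + norm_dim)) * morrey_denom l 1"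
  using assms ball_vol_pos
  by (simp add: morrey_denom_def measure_dunkl_ball mnorm_ball[OF assms] powr_mult powr_powr powr_add
      ennreal_mult mult_ac)

lemma morrey_denom_pos: "0 < R \<Longrightarrow> 0 < morrey_denom l R"
  using ball_vol_pos mnorm_unit_ball
  by (simp add: morrey_denom_def measure_dunkl_ball mnorm_ball[of R] ennreal_zero_less_mult_iff powr_gt_zero)

lemma morrey_denom_finite: "0 < R \<Longrightarrow> morrey_denom l R < top"
  using mnorm_unit_ball
  by (simp add: morrey_denom_def mnorm_ball[of R] ennreal_mult_less_top)

lemma mixed_norm_indicator_ball: "mixed_norm m b k p q (indicator (ball 0 R)) = mnorm (indicator (ball 0 R))"
proof -
  have "(\<lambda>x. ennreal (cmod (indicator (ball 0 R) x))) = indicator (ball (0 :: real ^ 'n) R)"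
    by (auto simp: indicator_def)
  then show ?thesis by (simp add: mixed_norm_def)
qed

lemma mixed_norm_mult_indicator_ball:
  "mixed_norm m b k p q (\<lambda>x. f x * indicator (ball 0 R) x) = mnorm (\<lambda>x. ennreal (cmod (f x)) * indicator (ball 0 R) x)"
proof -
  have "(\<lambda>x. ennreal (cmod (f x * indicator (ball 0 R) x))) = (\<lambda>x. ennreal (cmod (f x)) * indicator (ball (0 :: real ^ 'n) R) x)"
    by (auto simp: indicator_def)
  then show ?thesis by (simp add: mixed_norm_def)
qed

lemma morrey_norm_eq:
  "morrey_norm m b k p q l f =
    (SUP R\<in>{0<..}. mnorm (\<lambda>x. ennreal (cmod (f x)) * indicator (ball 0 R) x) / morrey_denom l R)"
  by (simp add: morrey_norm_def morrey_denom_def mixed_norm_indicator_ball mixed_norm_mult_indicator_ball)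

text \<open>The denominators are positive and finite, so the quotient under the supremum can be
  multiplied out; this lemma and the next spare all later estimates the division.\<close>

lemma mnorm_le_morrey_norm:
  assumes "0 < R"
  shows "mnorm (\<lambda>x. ennreal (cmod (f x)) * indicator (ball 0 R) x) \<le> morrey_norm m b k p q l f * morrey_denom l R"
    (is "?n \<le> _")
proof -
  have "?n / morrey_denom l R \<le> morrey_norm m b k p q l f"
    unfolding morrey_norm_eq by (rule SUP_upper) (use assms in simp)
  then have "?n / morrey_denom l R * morrey_denom l R \<le> morrey_norm m b k p q l f * morrey_denom l R"
    by (rule mult_right_mono) simp
  moreover have "?n / morrey_denom l R * morrey_denom l R = ?n"
    using morrey_denom_pos[OF assms, of l] morrey_denom_finite[OF assms, of l]
    by (simp add: ennreal_divide_times ennreal_times_divide mult_divide_eq_ennreal less_top[symmetric])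
  ultimately show ?thesis by simp
qed

lemma morrey_norm_le:
  assumes "\<And>R. 0 < R \<Longrightarrow> mnorm (\<lambda>x. ennreal (cmod (f x)) * indicator (ball 0 R) x) \<le> M * morrey_denom l R"
  shows "morrey_norm m b k p q l f \<le> M"
  unfolding morrey_norm_eq
proof (rule SUP_least)
  fix R :: real assume "R \<in> {0<..}"
  then have R: "0 < R" by simp
  have "mnorm (\<lambda>x. ennreal (cmod (f x)) * indicator (ball 0 R) x) / morrey_denom l R
      \<le> M * morrey_denom l R / morrey_denom l R"
    by (intro divide_right_mono_ennreal assms R)
  also have "\<dots> = M"
    using morrey_denom_pos[OF R, of l] morrey_denom_finite[OF R, of l] by (simp add: mult_divide_eq_ennreal)
  finally show "mnorm (\<lambda>x. ennreal (cmod (f x)) * indicator (ball 0 R) x) / morrey_denom l R \<le> M" .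
qed

text \<open>
  A power of the norm on the unit ball is dominated by an integral of indicator functions of balls,
  to which Minkowski's inequality applies.
\<close>

lemma mnorm_norm_powr_ball_finite:
  assumes a: "0 < a + norm_dim"
  shows "mnorm (\<lambda>x. ennreal (norm x powr a) * indicator (ball 0 1) x) < top"
proof -
  \<comment> \<open>For \<open>s\<close> between \<open>r\<close> and \<open>2 * r\<close> the ratio
    of \<open>s powr (a - 1)\<close> to \<open>r powr (a - 1)\<close> is at least \<open>1\<close>
    or at least \<open>2 powr (a - 1)\<close>, according to the sign of \<open>a - 1\<close>;
    \<kappa> is the smaller bound.\<close>
  define \<kappa> where "\<kappa> = min 1 (2 powr (a - 1))"
  have \<kappa>: "0 < \<kappa>" by (simp add: \<kappa>_def)
  \<comment> \<open>A point of norm \<open>r < 1\<close> lies in all balls of radius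
    \<open>s > r\<close>, and the radii up to \<open>2 * r\<close> already give a multiple of
    \<open>r powr a\<close>. All of them are below \<open>2\<close>, so cutting off there loses
    nothing and leaves only the behaviour at \<open>0\<close> to control.\<close>
  define c where "c s = ennreal (s powr (a - 1)) * indicator {0<..2} s" for s :: real
  have [measurable]: "c \<in> borel_measurable borel"
    unfolding c_def by measurable
  have F: "(\<lambda>(s, x). c s * indicator (ball 0 s) x) \<in> borel_measurable (lborel \<Otimes>\<^sub>M (borel :: (real ^ 'n) measure))"
  proof -
    have "(\<lambda>w. c (fst w) * (if norm (snd w) < fst w then 1 else 0)) \<in> borel_measurable (lborel \<Otimes>\<^sub>M (borel :: (real ^ 'n) measure))"
      by measurable
    then show ?thesis
      by (simp add: case_prod_beta indicator_def of_bool_def dist_norm)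
  qed
  have le: "ennreal \<kappa> * (ennreal (norm x powr a) * indicator (ball 0 1) x) \<le> (\<integral>\<^sup>+s. c s * indicator (ball 0 s) x \<partial>lborel)"
    for x :: "real ^ 'n"
  proof (cases "x = 0 \<or> x \<notin> ball 0 1")
    case True
    then show ?thesis by auto
  next
    case False
    define r where "r = norm x"
    have r: "0 < r" "r < 1" using False by (auto simp: r_def)
    have "ennreal \<kappa> * (ennreal (norm x powr a) * indicator (ball 0 1) x) = ennreal (\<kappa> * r powr (a - 1)) * ennreal r"
      using False r \<kappa> by (simp add: r_def[symmetric] ennreal_mult[symmetric] powr_diff)
    also have "ennreal r = emeasure lborel {r<..2 * r}"
      using r by simp
    also have "ennreal (\<kappa> * r powr (a - 1)) * emeasure lborel {r<..2 * r} = (\<integral>\<^sup>+s. ennreal (\<kappa> * r powr (a - 1)) * indicator {r<..2 * r} s \<partial>lborel)"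
      by (simp add: nn_integral_cmult_indicator)
    also have "\<dots> \<le> (\<integral>\<^sup>+s. c s * indicator (ball 0 s) x \<partial>lborel)"
    proof (intro nn_integral_mono)
      fix s :: real
      show "ennreal (\<kappa> * r powr (a - 1)) * indicator {r<..2 * r} s \<le> c s * indicator (ball 0 s) x"
      proof (cases "s \<in> {r<..2 * r}")
        case True
        have "\<kappa> * r powr (a - 1) \<le> s powr (a - 1)"
        proof (cases "1 \<le> a")
          case ge: True
          have "\<kappa> * r powr (a - 1) \<le> 1 * r powr (a - 1)"
            by (intro mult_right_mono) (auto simp: \<kappa>_def)
          also have "\<dots> \<le> s powr (a - 1)"
            using True r ge by (simp add: powr_mono2)
          finally show ?thesis .
        next
          case lt: False
          have "\<kappa> * r powr (a - 1) \<le> 2 powr (a - 1) * r powr (a - 1)"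
            by (intro mult_right_mono) (auto simp: \<kappa>_def)
          also have "\<dots> = (2 * r) powr (a - 1)"
            using r by (simp add: powr_mult)
          also have "\<dots> \<le> s powr (a - 1)"
            using True r lt by (intro powr_mono2') auto
          finally show ?thesis .
        qed
        with True r show ?thesis
          by (simp add: c_def r_def[symmetric] ennreal_leI)
      qed simp
    qed
    finally show ?thesis .
  qed
  have "ennreal \<kappa> * mnorm (\<lambda>x. ennreal (norm x powr a) * indicator (ball 0 1) x)
      = mnorm (\<lambda>x. ennreal \<kappa> * (ennreal (norm x powr a) * indicator (ball 0 1) x))"
    by (rule mnorm_cmult[symmetric]) measurable
  also have "\<dots> \<le> mnorm (\<lambda>x. \<integral>\<^sup>+s. c s * indicator (ball 0 s) x \<partial>lborel)"
    by (intro mnorm_mono le)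
  also have "\<dots> \<le> (\<integral>\<^sup>+s. mnorm (\<lambda>x. c s * indicator (ball 0 s) x) \<partial>lborel)"
    by (rule iterated_norm_Minkowski[OF order_refl sigma_finite_lborel F])
  \<comment> \<open>The norm of the ball of radius \<open>s\<close> supplies the factor
    \<open>s powr norm_dim\<close>, which makes the exponent integrable at \<open>0\<close> by the
    assumption on \<open>a\<close>.\<close>
  also have "\<dots> = (\<integral>\<^sup>+s. mnorm (indicator (ball 0 1)) * (ennreal (s powr (a + norm_dim - 1)) * indicator {0<..2} s) \<partial>lborel)"
  proof (intro nn_integral_cong)
    fix s :: real
    have "mnorm (\<lambda>x. c s * indicator (ball 0 s) x) = c s * mnorm (indicator (ball 0 s))"
      by (rule mnorm_cmult) measurable
    moreover have "ennreal (s powr (a + norm_dim - 1)) = ennreal (s powr (a - 1)) * ennreal (s powr norm_dim)" if "0 < s"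
      using that by (simp add: ennreal_mult[symmetric] powr_add[symmetric] algebra_simps)
    ultimately show "mnorm (\<lambda>x. c s * indicator (ball 0 s) x)
        = mnorm (indicator (ball 0 1)) * (ennreal (s powr (a + norm_dim - 1)) * indicator {0<..2} s)"
      by (cases "0 < s") (simp_all add: c_def mnorm_ball[of s] mult_ac)
  qed
  also have "\<dots> = mnorm (indicator (ball 0 1)) * (\<integral>\<^sup>+s. ennreal (s powr (a + norm_dim - 1)) * indicator {0<..2} s \<partial>lborel)"
    by (rule nn_integral_cmult) measurable
  also have "\<dots> < top"
    using nn_integral_powr_finite[OF a, of 2] mnorm_unit_ball by (simp add: ennreal_mult_less_top)
  finally have "ennreal \<kappa> * mnorm (\<lambda>x. ennreal (norm x powr a) * indicator (ball 0 1) x) \<noteq> top"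
    by (simp only: less_top)
  with \<kappa> have "mnorm (\<lambda>x. ennreal (norm x powr a) * indicator (ball 0 1) x) \<noteq> top"
    by (auto simp: ennreal_mult_top)
  then show ?thesis
    by (simp only: less_top)
qed

lemma mnorm_norm_powr_ball_pos: "0 < mnorm (\<lambda>x. ennreal (norm x powr a) * indicator (ball 0 1) x)"
proof -
  have meas: "(\<lambda>x :: real ^ 'n. ennreal (norm x powr a) * indicator (ball 0 1) x) \<in> borel_measurable borel"
    by measurable
  have "\<not> (AE x in lborel. ennreal (norm (x :: real ^ 'n) powr a) * indicator (ball 0 1) x = 0)"
  proof
    assume "AE x in lborel. ennreal (norm (x :: real ^ 'n) powr a) * indicator (ball 0 1) x = 0"
    moreover have "AE x in lborel. (x :: real ^ 'n) \<noteq> 0"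
      by (rule AE_lborel_singleton)
    ultimately have "AE x in lborel. (x :: real ^ 'n) \<in> ball 0 1 \<longrightarrow> False"
      by eventually_elim (auto simp: indicator_def)
    then show False using AE_ball_imp_ex[of "\<lambda>_ :: real ^ 'n. False"] by simp
  qed
  then show ?thesis
    unfolding zero_less_iff_neq_zero iterated_norm_full_eq_0_iff[OF meas] .
qed

text \<open>Combines the dilation law of the norm with the homogeneity of the power. For
  \<open>a = hom_dim * l\<close> the exponent coincides with that of the Morrey denominator.\<close>

lemma mnorm_norm_powr_ball:
  assumes "0 < R"
  shows "mnorm (\<lambda>x. ennreal (norm x powr a) * indicator (ball 0 R) x)
    = ennreal (R powr (a + norm_dim)) * mnorm (\<lambda>x. ennreal (norm x powr a) * indicator (ball 0 1) x)"
proof -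
  let ?G = "\<lambda>x :: real ^ 'n. ennreal (norm x powr a) * indicator (ball 0 1) x"
  let ?F = "\<lambda>x :: real ^ 'n. ennreal (norm x powr a) * indicator (ball 0 R) x"
  have "(\<lambda>x. ?F (R *\<^sub>R x)) = (\<lambda>x. ennreal (R powr a) * ?G x)"
    using assms ball_indicator_scale[OF assms, of 1, where ?'a = ennreal]
    by (auto simp: powr_mult ennreal_mult mult.assoc)
  moreover have "mnorm (\<lambda>x. ?F (R *\<^sub>R x)) = ennreal (R powr (- norm_dim)) * mnorm ?F"
    using assms by (intro mnorm_scale) measurable
  moreover have "mnorm (\<lambda>x. ennreal (R powr a) * ?G x) = ennreal (R powr a) * mnorm ?G"
    by (rule mnorm_cmult) measurable
  ultimately have "ennreal (R powr norm_dim) * (ennreal (R powr a) * mnorm ?G)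
      = (ennreal (R powr norm_dim) * ennreal (R powr (- norm_dim))) * mnorm ?F"
    by (simp add: mult.assoc)
  also have "ennreal (R powr norm_dim) * ennreal (R powr (- norm_dim)) = 1"
    using assms by (simp add: ennreal_mult[symmetric] powr_add[symmetric])
  finally show ?thesis
    using assms by (simp add: mult.assoc[symmetric] ennreal_mult[symmetric] powr_add[symmetric] add.commute)
qed

end

section \<open>The Hardy operator\<close>

lemma borel_measurable_lebesgue_complex_ex_borel:
  fixes f :: "'a::euclidean_space \<Rightarrow> complex"
  assumes f: "f \<in> borel_measurable lebesgue"
  shows "\<exists>g\<in>borel_measurable borel. AE x in lborel. f x = g x"
proof -
  have Re: "(\<lambda>x. Re (f x)) \<in> borel_measurable lebesgue" and Im: "(\<lambda>x. Im (f x)) \<in> borel_measurable lebesgue"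
    using f by simp_all
  obtain u where u: "u \<in> borel_measurable lborel" "AE x in lborel. Re (f x) = u x"
    using completion_ex_borel_measurable_real[OF Re] by blast
  obtain v where v: "v \<in> borel_measurable lborel" "AE x in lborel. Im (f x) = v x"
    using completion_ex_borel_measurable_real[OF Im] by blast
  have [measurable]: "u \<in> borel_measurable borel" "v \<in> borel_measurable borel"
    using u(1) v(1) by simp_all
  have "(\<lambda>x. complex_of_real (u x) + \<i> * complex_of_real (v x)) \<in> borel_measurable borel"
    by measurable
  moreover have "AE x in lborel. f x = complex_of_real (u x) + \<i> * complex_of_real (v x)"
    using u(2) v(2) by eventually_elim (simp add: complex_eq_iff)
  ultimately show ?thesis
    by (intro bexI[of _ "\<lambda>x. complex_of_real (u x) + \<i> * complex_of_real (v x)"])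
qed

text \<open>Every dilate of a null set is null; exchanging the point and the dilation factor by
  Fubini shows that almost every ray meets the set in a null set of parameters. The Hardy operator
  integrates along exactly these rays.\<close>

lemma AE_lborel_rays:
  fixes P :: "'a::euclidean_space \<Rightarrow> bool"
  assumes "AE x in lborel. P x"
  shows "AE x in lborel. AE t in lborel. 0 < t \<longrightarrow> P (t *\<^sub>R x)"
proof -
  obtain N where N: "N \<in> null_sets lborel" "{x. \<not> P x} \<subseteq> N"
    using assms by (auto simp: eventually_ae_filter)
  then have [measurable]: "N \<in> sets borel" by auto
  have N': "AE x in lborel. x \<notin> N"
    using N(1) by (rule AE_not_in)
  have "AE t in lborel. AE x in lborel. 0 < t \<longrightarrow> t *\<^sub>R x \<notin> N"
  proof (rule AE_I2)
    fix t :: real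
    have "{x. x \<notin> N} \<in> sets borel"
      using borel_comp[of N] by (simp add: Compl_eq)
    then have "0 < t \<Longrightarrow> AE x in lborel. t *\<^sub>R x \<notin> N"
      using AE_lborel_scaleR_iff[of t "\<lambda>x. x \<notin> N"] N' by simp
    then show "AE x in lborel. 0 < t \<longrightarrow> t *\<^sub>R x \<notin> N"
      by (cases "0 < t") auto
  qed
  then have "AE x in lborel. AE t in lborel. 0 < t \<longrightarrow> t *\<^sub>R x \<notin> N"
    by (subst (asm) lborel_pair.AE_commute) measurable
  then show ?thesis
    using N(2) by (auto elim!: eventually_mono)
qed

text \<open>\<psi> is a Borel version of \<phi>, non-negative everywhere and extended by
  \<open>0\<close>, so that all integrals can be taken over the whole line with respect to
  \<open>lborel\<close>.\<close>

locale hardy_morrey = dunkl_blocks b k m p q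
  for b :: "'n::finite \<Rightarrow> nat" and k :: "'n \<Rightarrow> real" and m :: nat and p q :: "nat \<Rightarrow> real" +
  fixes l :: real and \<phi> \<psi> :: "real \<Rightarrow> real"
  assumes l_gt: "0 < hom_dim * l + norm_dim"
    and \<phi>_nonneg: "t \<in> {0<..1} \<Longrightarrow> 0 \<le> \<phi> t"
    and \<psi>_measurable [measurable]: "\<psi> \<in> borel_measurable borel"
    and \<psi>_nonneg: "0 \<le> \<psi> t"
    and \<psi>_eq_0: "t \<notin> {0<..1} \<Longrightarrow> \<psi> t = 0"
    and \<psi>_eq_\<phi>: "AE t in lborel. t \<in> {0<..1} \<longrightarrow> \<psi> t = \<phi> t"
begin

definition hardy_const :: ennreal where
  "hardy_const = (\<integral>\<^sup>+t. ennreal (t powr (hom_dim * l) * \<psi> t) \<partial>lborel)"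

lemma nn_integral_\<phi>_eq_hardy_const:
  "(\<integral>\<^sup>+t\<in>{0<..1}. ennreal (t powr (hom_dim * l) * \<phi> t) \<partial>lebesgue) = hardy_const"
  unfolding hardy_const_def nn_integral_completion
  by (rule nn_integral_cong_AE) (use \<psi>_eq_\<phi> in eventually_elim, use \<psi>_eq_0 in \<open>auto simp: indicator_def\<close>)

lemma hardy_integrand_AE_eq:
  assumes "AE t in lborel. 0 < t \<longrightarrow> f (t *\<^sub>R x) = (g (t *\<^sub>R x) :: complex)"
  shows "AE t in lebesgue. \<psi> t *\<^sub>R g (t *\<^sub>R x) = indicator {0<..1} t *\<^sub>R (f (t *\<^sub>R x) * complex_of_real (\<phi> t))"
proof (rule AE_completion)
  show "AE t in lborel. \<psi> t *\<^sub>R g (t *\<^sub>R x) = indicator {0<..1} t *\<^sub>R (f (t *\<^sub>R x) * complex_of_real (\<phi> t))"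
    using assms \<psi>_eq_\<phi>
  proof eventually_elim
    case (elim t)
    then show ?case
      using \<psi>_eq_0[of t] by (cases "t \<in> {0<..1}") (auto simp: scaleR_conv_of_real mult.commute)
  qed
qed

text \<open>Only the values of \<open>f\<close> on the ray through \<open>x\<close>, up to a null
  set of parameters, enter the operator; the integrand inherits its measurability from the Borel
  function \<open>g\<close>.\<close>

lemma
  fixes g :: "real ^ 'n \<Rightarrow> complex"
  assumes g[measurable]: "g \<in> borel_measurable borel"
    and ae: "AE t in lborel. 0 < t \<longrightarrow> f (t *\<^sub>R x) = g (t *\<^sub>R x)"
  shows hardy_defined_at_iff_borel: "hardy_defined_at \<phi> f x \<longleftrightarrow> integrable lborel (\<lambda>t. \<psi> t *\<^sub>R g (t *\<^sub>R x))"
    and hardy_eq_borel: "hardy \<phi> f x = (LINT t|lborel. \<psi> t *\<^sub>R g (t *\<^sub>R x))"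
proof -
  let ?u = "\<lambda>t. indicator {0<..1} t *\<^sub>R (f (t *\<^sub>R x) * complex_of_real (\<phi> t))"
  let ?v = "\<lambda>t. \<psi> t *\<^sub>R g (t *\<^sub>R x)"
  note eq = hardy_integrand_AE_eq[OF ae]
  have v: "?v \<in> borel_measurable lborel" by measurable
  then have v': "?v \<in> borel_measurable lebesgue" by (rule measurable_completion)
  then have u': "?u \<in> borel_measurable lebesgue" using eq by (rule borel_measurable_AE)
  have "integrable lebesgue ?v \<longleftrightarrow> integrable lebesgue ?u"
    by (rule integrable_cong_AE[OF v' u' eq])
  then show "hardy_defined_at \<phi> f x \<longleftrightarrow> integrable lborel ?v"
    by (simp add: hardy_defined_at_def set_integrable_def integrable_completion[OF v])
  have "integral\<^sup>L lebesgue ?v = integral\<^sup>L lebesgue ?u"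
    by (rule integral_cong_AE[OF v' u' eq])
  then show "hardy \<phi> f x = integral\<^sup>L lborel ?v"
    by (simp add: hardy_def set_lebesgue_integral_def integral_completion[OF v])
qed

section \<open>Boundedness and the upper estimate\<close>

definition hardy_abs :: "(real ^ 'n \<Rightarrow> complex) \<Rightarrow> real ^ 'n \<Rightarrow> ennreal" where
  "hardy_abs g x = (\<integral>\<^sup>+t. ennreal (\<psi> t) * ennreal (cmod (g (t *\<^sub>R x))) \<partial>lborel)"

lemma measurable_hardy_abs:
  assumes [measurable]: "g \<in> borel_measurable borel"
  shows "hardy_abs g \<in> borel_measurable borel"
  unfolding hardy_abs_def[abs_def] by measurable

text \<open>With the modulus inside, the integral is an extended number at every point, so a single
  estimate yields both existence almost everywhere and the norm bound. Dilation costs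
  \<open>t powr (- norm_dim)\<close>, and passing from radius \<open>R\<close> to
  \<open>t * R\<close> in the denominator gains \<open>t powr (hom_dim * l + norm_dim)\<close>. The
  constant \<open>M\<close> is left free because it will be the Morrey norm of \<open>f\<close>, not
  of its Borel version \<open>g\<close>.\<close>

lemma mnorm_hardy_abs_le:
  assumes g[measurable]: "g \<in> borel_measurable borel"
    and M: "\<And>r. 0 < r \<Longrightarrow> mnorm (\<lambda>x. ennreal (cmod (g x)) * indicator (ball 0 r) x) \<le> M * morrey_denom l r"
    and R: "0 < R"
  shows "mnorm (\<lambda>x. hardy_abs g x * indicator (ball 0 R) x) \<le> hardy_const * (M * morrey_denom l R)"
proof -
  let ?F = "\<lambda>t x. ennreal (\<psi> t) * (ennreal (cmod (g (t *\<^sub>R x))) * indicator (ball 0 R) x)"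
  let ?H = "\<lambda>r x. ennreal (cmod (g x)) * indicator (ball 0 r) x"
  have "(\<lambda>x. hardy_abs g x * indicator (ball 0 R) x) = (\<lambda>x. \<integral>\<^sup>+t. ?F t x \<partial>lborel)"
    unfolding hardy_abs_def by (auto simp: nn_integral_multc[symmetric] mult.assoc)
  then have "mnorm (\<lambda>x. hardy_abs g x * indicator (ball 0 R) x) = mnorm (\<lambda>x. \<integral>\<^sup>+t. ?F t x \<partial>lborel)"
    by simp
  also have "\<dots> \<le> (\<integral>\<^sup>+t. mnorm (?F t) \<partial>lborel)"
    by (rule iterated_norm_Minkowski[OF order_refl sigma_finite_lborel]) measurable
  also have "\<dots> \<le> (\<integral>\<^sup>+t. ennreal (t powr (hom_dim * l) * \<psi> t) * (M * morrey_denom l R) \<partial>lborel)"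
  proof (intro nn_integral_mono)
    fix t :: real
    have eq: "mnorm (?F t) = ennreal (\<psi> t) * mnorm (\<lambda>x. ennreal (cmod (g (t *\<^sub>R x))) * indicator (ball 0 R) x)"
      by (rule mnorm_cmult) measurable
    show "mnorm (?F t) \<le> ennreal (t powr (hom_dim * l) * \<psi> t) * (M * morrey_denom l R)"
    proof (cases "0 < t")
      case False
      then show ?thesis using \<psi>_eq_0[of t] eq by simp
    next
      case t: True
      have "mnorm (\<lambda>x. ennreal (cmod (g (t *\<^sub>R x))) * indicator (ball 0 R) x) = mnorm (\<lambda>x. ?H (t * R) (t *\<^sub>R x))"
        using t by (simp add: ball_indicator_scale)
      also have "\<dots> = ennreal (t powr (- norm_dim)) * mnorm (?H (t * R))"
        using t by (intro mnorm_scale) measurable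
      also have "\<dots> \<le> ennreal (t powr (- norm_dim)) * (M * morrey_denom l (t * R))"
        using t R by (intro mult_left_mono M) auto
      also have "morrey_denom l (t * R) = ennreal (t powr (hom_dim * l + norm_dim)) * morrey_denom l R"
        using t R by (simp add: morrey_denom_scale[of "t * R"] morrey_denom_scale[of R] powr_mult ennreal_mult mult.assoc)
      also have "ennreal (t powr (- norm_dim)) * (M * (ennreal (t powr (hom_dim * l + norm_dim)) * morrey_denom l R))
          = (ennreal (t powr (- norm_dim)) * ennreal (t powr (hom_dim * l + norm_dim))) * (M * morrey_denom l R)"
        by (simp only: mult_ac)
      also have "ennreal (t powr (- norm_dim)) * ennreal (t powr (hom_dim * l + norm_dim)) = ennreal (t powr (hom_dim * l))"
        using t by (simp add: ennreal_mult[symmetric] powr_add[symmetric])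
      finally have "mnorm (?F t) \<le> ennreal (\<psi> t) * (ennreal (t powr (hom_dim * l)) * (M * morrey_denom l R))"
        unfolding eq by (rule mult_left_mono) simp
      also have "\<dots> = ennreal (t powr (hom_dim * l) * \<psi> t) * (M * morrey_denom l R)"
        using \<psi>_nonneg[of t] by (simp add: ennreal_mult mult_ac)
      finally show ?thesis .
    qed
  qed
  also have "\<dots> = hardy_const * (M * morrey_denom l R)"
    unfolding hardy_const_def by (rule nn_integral_multc) measurable
  finally show ?thesis .
qed

lemma hardy_bound:
  assumes f: "f \<in> morrey_space m b k p q l" and A: "hardy_const < top"
  shows "AE x in lebesgue. hardy_defined_at \<phi> f x"
    and "hardy \<phi> f \<in> borel_measurable lebesgue"
    and "morrey_norm m b k p q l (hardy \<phi> f) \<le> hardy_const * morrey_norm m b k p q l f"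
proof -
  let ?M = "morrey_norm m b k p q l f"
  have M: "?M < top" and f_meas: "f \<in> borel_measurable lebesgue"
    using f by (auto simp: morrey_space_def)
  obtain g where g[measurable]: "g \<in> borel_measurable borel" and fg: "AE x in lborel. f x = g x"
    using borel_measurable_lebesgue_complex_ex_borel[OF f_meas] by auto
  define h where "h x = (LINT t|lborel. \<psi> t *\<^sub>R g (t *\<^sub>R x))" for x
  have h[measurable]: "h \<in> borel_measurable borel"
    unfolding h_def[abs_def] by measurable
  have ray: "AE x in lborel. AE t in lborel. 0 < t \<longrightarrow> f (t *\<^sub>R x) = g (t *\<^sub>R x)"
    by (rule AE_lborel_rays[OF fg])
  have hardy_h: "AE x in lborel. h x = hardy \<phi> f x"
    using ray by eventually_elim (simp add: h_def hardy_eq_borel[OF g])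
  have S: "mnorm (\<lambda>x. hardy_abs g x * indicator (ball 0 R) x) \<le> hardy_const * (?M * morrey_denom l R)" if "0 < R" for R
  proof (rule mnorm_hardy_abs_le[OF g _ that])
    fix r :: real assume r: "0 < r"
    have "mnorm (\<lambda>x. ennreal (cmod (g x)) * indicator (ball 0 r) x) = mnorm (\<lambda>x. ennreal (cmod (f x)) * indicator (ball 0 r) x)"
      by (rule iterated_norm_cong_AE) (use fg in eventually_elim, simp)
    also have "\<dots> \<le> ?M * morrey_denom l r"
      by (rule mnorm_le_morrey_norm[OF r])
    finally show "mnorm (\<lambda>x. ennreal (cmod (g x)) * indicator (ball 0 r) x) \<le> ?M * morrey_denom l r" .
  qed
  have norm_integrand: "(\<integral>\<^sup>+t. ennreal (norm (\<psi> t *\<^sub>R g (t *\<^sub>R x))) \<partial>lborel) = hardy_abs g x" for x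
    unfolding hardy_abs_def using \<psi>_nonneg by (simp add: ennreal_mult abs_of_nonneg)
  \<comment> \<open>The Morrey norm controls balls only, so finiteness is obtained on a countable
    family of balls that exhausts the space; \<open>Suc i\<close> keeps the radii positive.\<close>
  have fin: "AE x in lborel. hardy_abs g x < top"
  proof -
    have "AE x in lborel. hardy_abs g x * indicator (ball 0 (real (Suc i))) x < top" for i
    proof (rule iterated_norm_finite_imp_AE_finite)
      show "(\<lambda>x. hardy_abs g x * indicator (ball 0 (real (Suc i))) x) \<in> borel_measurable borel"
        using measurable_hardy_abs[OF g, measurable] by measurable
      show "mnorm (\<lambda>x. hardy_abs g x * indicator (ball 0 (real (Suc i))) x) < top"
        using S[of "real (Suc i)"] A M morrey_denom_finite[of "real (Suc i)" l]
        by (intro le_less_trans[OF S]) (auto simp: ennreal_mult_less_top)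
    qed
    then have "AE x in lborel. \<forall>i. hardy_abs g x * indicator (ball 0 (real (Suc i))) x < top"
      by (simp add: AE_all_countable)
    then show ?thesis
    proof eventually_elim
      case (elim x)
      obtain i where "norm x < real i" using reals_Archimedean2 by blast
      then have "x \<in> ball 0 (real (Suc i))" by simp
      with elim[rule_format, of i] show ?case by simp
    qed
  qed
  have "AE x in lborel. hardy_defined_at \<phi> f x"
    using ray fin
  proof eventually_elim
    case (elim x)
    then have "integrable lborel (\<lambda>t. \<psi> t *\<^sub>R g (t *\<^sub>R x))"
      by (intro integrableI_bounded) (measurable, simp only: norm_integrand infinity_ennreal_def)
    then show ?case by (simp only: hardy_defined_at_iff_borel[OF g elim(1)])
  qed
  then show "AE x in lebesgue. hardy_defined_at \<phi> f x"
    by (rule AE_completion)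
  have "h \<in> borel_measurable lebesgue"
    by (intro measurable_completion) measurable
  then show "hardy \<phi> f \<in> borel_measurable lebesgue"
    using AE_completion[OF hardy_h] by (rule borel_measurable_AE)
  show "morrey_norm m b k p q l (hardy \<phi> f) \<le> hardy_const * ?M"
  proof (rule morrey_norm_le)
    fix R :: real assume R: "0 < R"
    \<comment> \<open>Where the integrand is not integrable, \<open>h x\<close> has the default
      value \<open>0\<close>, so the bound holds at every point.\<close>
    have h_le: "ennreal (cmod (h x)) \<le> hardy_abs g x" for x
    proof (cases "integrable lborel (\<lambda>t. \<psi> t *\<^sub>R g (t *\<^sub>R x))")
      case True
      then show ?thesis
        using integral_norm_bound_ennreal[OF True] unfolding h_def norm_integrand by simp
    next
      case False
      then show ?thesis by (simp add: h_def not_integrable_integral_eq)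
    qed
    have "mnorm (\<lambda>x. ennreal (cmod (hardy \<phi> f x)) * indicator (ball 0 R) x) = mnorm (\<lambda>x. ennreal (cmod (h x)) * indicator (ball 0 R) x)"
      by (rule iterated_norm_cong_AE) (use hardy_h in eventually_elim, simp)
    also have "\<dots> \<le> mnorm (\<lambda>x. hardy_abs g x * indicator (ball 0 R) x)"
      by (intro mnorm_mono mult_right_mono h_le) simp
    also have "\<dots> \<le> hardy_const * (?M * morrey_denom l R)"
      by (rule S[OF R])
    finally show "mnorm (\<lambda>x. ennreal (cmod (hardy \<phi> f x)) * indicator (ball 0 R) x) \<le> hardy_const * ?M * morrey_denom l R"
      by (simp add: mult.assoc)
  qed
qed

lemma hardy_const_mem_bounds:
  assumes "hardy_const < top"
  shows "enn2real hardy_const \<in> hardy_bounds m b k p q l \<phi>"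
proof -
  have A: "ennreal (enn2real hardy_const) = hardy_const"
    using assms by simp
  show ?thesis
    unfolding hardy_bounds_def
  proof (intro CollectI conjI ballI)
    fix f assume f: "f \<in> morrey_space m b k p q l"
    note bound = hardy_bound[OF f assms]
    show "AE x in lebesgue. hardy_defined_at \<phi> f x" by (rule bound)
    show "morrey_norm m b k p q l (hardy \<phi> f) \<le> ennreal (enn2real hardy_const) * morrey_norm m b k p q l f"
      unfolding A by (rule bound)
    have "hardy_const * morrey_norm m b k p q l f < \<infinity>"
      using f assms by (auto simp: morrey_space_def ennreal_mult_less_top)
    with bound(2,3) show "hardy \<phi> f \<in> morrey_space m b k p q l"
      by (auto simp: morrey_space_def intro: le_less_trans)
  qed simp
qed

section \<open>The extremal function and the lower estimate\<close>

definition extremal :: "real ^ 'n \<Rightarrow> complex" where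
  "extremal x = complex_of_real (norm x powr (hom_dim * l))"

abbreviation extremal_norm :: ennreal where
  "extremal_norm \<equiv> mnorm (\<lambda>x. ennreal (norm x powr (hom_dim * l)) * indicator (ball 0 1) x)"

lemma extremal_norm: "0 < extremal_norm" "extremal_norm < top"
  using mnorm_norm_powr_ball_pos mnorm_norm_powr_ball_finite[OF l_gt] by auto

text \<open>Numerator and denominator of the Morrey quotient scale with the same power of
  \<open>R\<close>, so the quotient is the one for \<open>R = 1\<close>.\<close>

lemma morrey_norm_extremal_le: "morrey_norm m b k p q l extremal \<le> extremal_norm / morrey_denom l 1"
proof (rule morrey_norm_le)
  fix R :: real assume R: "0 < R"
  have "mnorm (\<lambda>x. ennreal (cmod (extremal x)) * indicator (ball 0 R) x)
      = ennreal (R powr (hom_dim * l + norm_dim)) * extremal_norm"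
    using mnorm_norm_powr_ball[OF R, of "hom_dim * l"] by (simp add: extremal_def)
  also have "extremal_norm = extremal_norm / morrey_denom l 1 * morrey_denom l 1"
    using morrey_denom_pos[of 1 l] morrey_denom_finite[of 1 l]
    by (simp add: ennreal_divide_times ennreal_times_divide mult_divide_eq_ennreal less_top[symmetric])
  also have "ennreal (R powr (hom_dim * l + norm_dim)) * (extremal_norm / morrey_denom l 1 * morrey_denom l 1)
      = extremal_norm / morrey_denom l 1 * morrey_denom l R"
    by (simp only: morrey_denom_scale[OF R] mult_ac)
  finally show "mnorm (\<lambda>x. ennreal (cmod (extremal x)) * indicator (ball 0 R) x)
      \<le> extremal_norm / morrey_denom l 1 * morrey_denom l R"
    by simp
qed

lemma extremal_mem_morrey_space: "extremal \<in> morrey_space m b k p q l"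
proof -
  have "extremal_norm / morrey_denom l 1 < top"
    using extremal_norm less_imp_neq[OF morrey_denom_pos[of 1 l]]
    by (simp add: ennreal_divide_eq_top_iff less_top[symmetric])
  moreover have "extremal \<in> borel_measurable lborel"
    unfolding extremal_def[abs_def] by measurable
  ultimately show ?thesis
    using morrey_norm_extremal_le by (auto simp: morrey_space_def intro: measurable_completion le_less_trans)
qed

lemma extremal_integrand:
  "indicator {0<..1} t *\<^sub>R (extremal (t *\<^sub>R x) * complex_of_real (\<phi> t))
    = complex_of_real (norm x powr (hom_dim * l) * (indicator {0<..1} t * (t powr (hom_dim * l) * \<phi> t)))"
  by (auto simp: extremal_def indicator_def powr_mult abs_of_pos)

text \<open>Testing an admissible \<open>C\<close> on the extremal function gives finiteness of the
  constant from mere existence of the operator, and the inequality from its being an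
  eigenfunction.\<close>

lemma hardy_const_le:
  assumes C: "C \<in> hardy_bounds m b k p q l \<phi>"
  shows "hardy_const \<le> ennreal C"
proof -
  let ?w = "\<lambda>t. indicator {0<..1} t * (t powr (hom_dim * l) * \<phi> t)"
  have "\<forall>f\<in>morrey_space m b k p q l. (AE x in lebesgue. hardy_defined_at \<phi> f x) \<and>
      hardy \<phi> f \<in> morrey_space m b k p q l \<and>
      morrey_norm m b k p q l (hardy \<phi> f) \<le> ennreal C * morrey_norm m b k p q l f"
    using C unfolding hardy_bounds_def by blast
  note * = bspec[OF this extremal_mem_morrey_space]
  from * have def: "AE x in lebesgue. hardy_defined_at \<phi> extremal x"
    and le: "morrey_norm m b k p q l (hardy \<phi> extremal) \<le> ennreal C * morrey_norm m b k p q l extremal"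
    by simp_all
  \<comment> \<open>One nonzero point at which the operator is defined suffices: there the power of
    the norm is a nonzero factor, and dividing by it leaves the integrability of the weight.\<close>
  have "AE x in lborel. x \<in> ball 0 1 \<longrightarrow> hardy_defined_at \<phi> extremal x \<and> x \<noteq> 0"
    using def[unfolded AE_completion_iff] AE_lborel_singleton[of "0 :: real ^ 'n"] by eventually_elim simp
  then obtain x0 :: "real ^ 'n" where x0: "hardy_defined_at \<phi> extremal x0" "x0 \<noteq> 0"
    using AE_ball_imp_ex[of "\<lambda>x. hardy_defined_at \<phi> extremal x \<and> x \<noteq> 0"] by auto
  from x0(1) have "integrable lebesgue (\<lambda>t. norm x0 powr (hom_dim * l) * ?w t)"
    unfolding hardy_defined_at_def set_integrable_def extremal_integrand complex_of_real_integrable_eq .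
  then have w: "integrable lebesgue ?w"
    using x0(2) by (simp only: integrable_mult_left_iff powr_eq_0_iff norm_eq_zero simp_thms)
  define A where "A = integral\<^sup>L lebesgue ?w"
  have w_nonneg: "0 \<le> ?w t" for t
    using \<phi>_nonneg[of t] by (auto simp: indicator_def)
  have A: "0 \<le> A"
    unfolding A_def by (intro integral_nonneg_AE AE_I2 w_nonneg)
  have "hardy_const = (\<integral>\<^sup>+t. ennreal (?w t) \<partial>lebesgue)"
    unfolding nn_integral_\<phi>_eq_hardy_const[symmetric] by (intro nn_integral_cong) (auto simp: indicator_def)
  also have "\<dots> = ennreal A"
    unfolding A_def by (rule nn_integral_eq_integral[OF w]) (simp add: w_nonneg)
  finally have const: "hardy_const = ennreal A" .
  have hardy: "hardy \<phi> extremal x = complex_of_real (norm x powr (hom_dim * l) * A)" for x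
    unfolding hardy_def set_lebesgue_integral_def extremal_integrand integral_complex_of_real
    by (simp add: A_def)
  \<comment> \<open>The comparison takes place on the unit ball; \<open>extremal_norm\<close> is
    positive and finite, so it cancels at the end.\<close>
  have "ennreal A * extremal_norm = mnorm (\<lambda>x. ennreal A * (ennreal (norm x powr (hom_dim * l)) * indicator (ball 0 1) x))"
    by (rule mnorm_cmult[symmetric]) measurable
  also have "\<dots> = mnorm (\<lambda>x. ennreal (cmod (hardy \<phi> extremal x)) * indicator (ball 0 1) x)"
    unfolding hardy using A by (simp add: norm_mult ennreal_mult mult_ac)
  also have "\<dots> \<le> morrey_norm m b k p q l (hardy \<phi> extremal) * morrey_denom l 1"
    by (rule mnorm_le_morrey_norm) simp
  also have "\<dots> \<le> (ennreal C * (extremal_norm / morrey_denom l 1)) * morrey_denom l 1"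
    by (intro mult_right_mono order.trans[OF le] mult_left_mono morrey_norm_extremal_le) auto
  also have "\<dots> = ennreal C * extremal_norm"
    using morrey_denom_pos[of 1 l] morrey_denom_finite[of 1 l]
    by (simp add: mult.assoc ennreal_divide_times ennreal_times_divide mult_divide_eq_ennreal less_top[symmetric])
  finally have "ennreal A * extremal_norm / extremal_norm \<le> ennreal C * extremal_norm / extremal_norm"
    by (rule divide_right_mono_ennreal)
  then show ?thesis
    using extremal_norm by (simp add: const mult_divide_eq_ennreal)
qed

lemma hardy_bounded_iff: "hardy_bounded m b k p q l \<phi> \<longleftrightarrow> hardy_const < top"
  unfolding hardy_bounded_def
  using hardy_const_mem_bounds hardy_const_le le_less_trans[OF _ ennreal_less_top] by blast

lemma hardy_opnorm_eq: "hardy_opnorm m b k p q l \<phi> = hardy_const"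
proof (rule antisym)
  show "hardy_const \<le> hardy_opnorm m b k p q l \<phi>"
    unfolding hardy_opnorm_def by (intro INF_greatest hardy_const_le)
  show "hardy_opnorm m b k p q l \<phi> \<le> hardy_const"
  proof (cases "hardy_const < top")
    case True
    then have "ennreal (enn2real hardy_const) = hardy_const" by simp
    with hardy_const_mem_bounds[OF True] show ?thesis
      unfolding hardy_opnorm_def by (metis INF_lower)
  qed (simp add: less_top[symmetric])
qed

end

text \<open>\<phi> is arbitrary outside the interval and merely Lebesgue measurable on it, so it is
  extended by \<open>0\<close> before a Borel version is taken. The positive part repairs the sign
  on the exceptional null set.\<close>

lemma ex_borel_weight:
  fixes \<phi> :: "real \<Rightarrow> real"
  assumes "\<phi> \<in> borel_measurable (lebesgue_on {0<..1})" and nonneg: "\<And>t. t \<in> {0<..1} \<Longrightarrow> 0 \<le> \<phi> t"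
  shows "\<exists>\<psi>\<in>borel_measurable borel. (\<forall>t. 0 \<le> \<psi> t) \<and> (\<forall>t. t \<notin> {0<..1} \<longrightarrow> \<psi> t = 0) \<and>
    (AE t in lborel. t \<in> {0<..1} \<longrightarrow> \<psi> t = \<phi> t)"
proof -
  have "(\<lambda>t. indicator {0<..1} t *\<^sub>R \<phi> t) \<in> borel_measurable lebesgue"
    using assms(1) by (subst (asm) borel_measurable_restrict_space_iff) auto
  then obtain g where g[measurable]: "g \<in> borel_measurable borel"
    and eq: "AE t in lborel. indicator {0<..1} t *\<^sub>R \<phi> t = g t"
    by (auto dest!: completion_ex_borel_measurable_real)
  let ?\<psi> = "\<lambda>t. indicator {0<..1} t * max 0 (g t)"
  have "?\<psi> \<in> borel_measurable borel" by measurable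
  moreover have "AE t in lborel. t \<in> {0<..1} \<longrightarrow> ?\<psi> t = \<phi> t"
    using eq
  proof eventually_elim
    case (elim t)
    then show ?case using nonneg[of t] by auto
  qed
  ultimately show ?thesis
    by (intro bexI[of _ ?\<psi>]) auto
qed

theorem theorem3p2:
  fixes m :: nat
    and b :: "'n::finite \<Rightarrow> nat"
    and k :: "'n \<Rightarrow> real"
    and p q :: "nat \<Rightarrow> real"
    and l :: real
    and \<phi> :: "real \<Rightarrow> real"
  assumes "2 \<le> CARD('n)"
    and "range b = {1..m}"
    and "\<And>j. 0 \<le> k j"
    and "\<And>i. i \<in> {1..m} \<Longrightarrow> 1 < p i"
    and "\<And>i. i \<in> {1..m} \<Longrightarrow> 1 < q i"
    and "l > - (1 / dunkl_dim k UNIV) * (\<Sum>i=1..m. dunkl_dim k (block b i) / p i)"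
    and "\<phi> \<in> borel_measurable (lebesgue_on {0<..1})"
    and "\<And>t. t \<in> {0<..1} \<Longrightarrow> 0 \<le> \<phi> t"
  shows "(hardy_bounded m b k p q l \<phi> \<longleftrightarrow>
            (\<integral>\<^sup>+t\<in>{0<..1}. ennreal (t powr (dunkl_dim k UNIV * l) * \<phi> t) \<partial>lebesgue) < \<infinity>) \<and>
         hardy_opnorm m b k p q l \<phi> =
            (\<integral>\<^sup>+t\<in>{0<..1}. ennreal (t powr (dunkl_dim k UNIV * l) * \<phi> t) \<partial>lebesgue)"
proof -
  interpret dunkl_blocks b k m p q
    by unfold_locales (use assms in auto)
  obtain \<psi> where \<psi>: "\<psi> \<in> borel_measurable borel" "\<And>t. 0 \<le> \<psi> t" "\<And>t. t \<notin> {0<..1} \<Longrightarrow> \<psi> t = 0"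
    "AE t in lborel. t \<in> {0<..1} \<longrightarrow> \<psi> t = \<phi> t"
    using ex_borel_weight[OF assms(7,8)] by blast
  have "0 < dunkl_dim k UNIV"
    using dunkl_dim_ge_1[of UNIV] by simp
  \<comment> \<open>The hypothesis on \<open>l\<close>, multiplied by the positive number
    \<open>dunkl_dim k UNIV\<close>.\<close>
  then have "0 < dunkl_dim k UNIV * l + norm_dim"
    using assms(6) by (simp add: norm_dim_def field_simps)
  then interpret hardy_morrey b k m p q l \<phi> \<psi>
    by unfold_locales (use assms \<psi> in auto)
  show ?thesis
    using hardy_bounded_iff hardy_opnorm_eq by (simp add: nn_integral_\<phi>_eq_hardy_const)
qed

end
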